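(* Let $G$ be a group that is residually torsion-free nilpotent and (Gromov) hyperbolic. Then $\operatorname{Aut}(G)$ acts faithfully on the Gromov boundary $\partial G$; that is, every non-identity automorphism of $G$ acts non-trivially on $\partial G$.
   Context: A group $G$ is residually torsion-free nilpotent if every non-identity element of $G$ has non-trivial image in some torsion-free nilpotent quotient of $G$. Hyperbolic groups are finitely generated groups whose Cayley graphs (with respect to a finite generating set) are $\delta$-hyperbolic for some $\delta\geq 0$. The Gromov boundary $\partial G$ is the set of equivalence classes of geodesic rays in the Cayley graph of $G$ emanating from a fixed basepoint, two rays being equivalent if they stay at bounded distance from each other, with its usual topology. An automorphism of $G$ is a quasi-isometry of $G$ with respect to the word metric and hence induces a homeomorphism of $\partial G$; this is the action of $\operatorname{Aut}(G)$ on $\partial G$. *)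

theory Defs
  imports Complex_Main "HOL-Algebra.Algebra"
begin

section \<open>Residually torsion-free nilpotent groups\<close>

primrec lower_central :: "('a, 'b) monoid_scheme \<Rightarrow> nat \<Rightarrow> 'a set" where
  "lower_central G 0 = carrier G"
| "lower_central G (Suc n) = generate G
     (\<Union>x \<in> lower_central G n. \<Union>y \<in> carrier G.
        {x \<otimes>\<^bsub>G\<^esub> y \<otimes>\<^bsub>G\<^esub> inv\<^bsub>G\<^esub> x \<otimes>\<^bsub>G\<^esub> inv\<^bsub>G\<^esub> y})"

definition nilpotent_group :: "('a, 'b) monoid_scheme \<Rightarrow> bool" where
  "nilpotent_group G \<longleftrightarrow> group G \<and> (\<exists>n. lower_central G n = {\<one>\<^bsub>G\<^esub>})"

definition torsion_free_group :: "('a, 'b) monoid_scheme \<Rightarrow> bool" where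
  "torsion_free_group G \<longleftrightarrow> group G \<and>
     (\<forall>x \<in> carrier G. \<forall>n::nat. n > 0 \<longrightarrow> x [^]\<^bsub>G\<^esub> n = \<one>\<^bsub>G\<^esub> \<longrightarrow> x = \<one>\<^bsub>G\<^esub>)"

definition residually_torsion_free_nilpotent :: "('a, 'b) monoid_scheme \<Rightarrow> bool" where
  "residually_torsion_free_nilpotent G \<longleftrightarrow> group G \<and>
     (\<forall>g \<in> carrier G. g \<noteq> \<one>\<^bsub>G\<^esub> \<longrightarrow>
        (\<exists>N. N \<lhd> G \<and> torsion_free_group (G Mod N) \<and> nilpotent_group (G Mod N) \<and>
             N #>\<^bsub>G\<^esub> g \<noteq> \<one>\<^bsub>G Mod N\<^esub>))"


section \<open>Word metric, Cayley graph geodesics, hyperbolicity\<close>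

definition finite_generating_set :: "('a, 'b) monoid_scheme \<Rightarrow> 'a set \<Rightarrow> bool" where
  "finite_generating_set G S \<longleftrightarrow> finite S \<and> S \<subseteq> carrier G \<and> generate G S = carrier G"

definition word_length :: "('a, 'b) monoid_scheme \<Rightarrow> 'a set \<Rightarrow> 'a \<Rightarrow> nat" where
  "word_length G S g =
     (LEAST n. \<exists>ws. set ws \<subseteq> S \<union> (\<lambda>s. inv\<^bsub>G\<^esub> s) ` S \<and> length ws = n \<and>
                     foldr (\<lambda>a b. a \<otimes>\<^bsub>G\<^esub> b) ws \<one>\<^bsub>G\<^esub> = g)"

text \<open>The path metric on the vertices of the (right) Cayley graph, whose edges join \<open>x\<close> to
  \<open>x s\<close> for \<open>s\<close> in \<open>S\<close>. It is left-invariant, and meaningful only when \<open>S\<close> generates \<open>G\<close>.\<close>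

definition word_dist :: "('a, 'b) monoid_scheme \<Rightarrow> 'a set \<Rightarrow> 'a \<Rightarrow> 'a \<Rightarrow> nat" where
  "word_dist G S x y = word_length G S (inv\<^bsub>G\<^esub> x \<otimes>\<^bsub>G\<^esub> y)"

text \<open>Geodesics of the Cayley graph starting at a vertex are recorded by the sequence of
  vertices they traverse, i.e. by their values at integer times. For a segment of length
  \<open>n\<close> only the values \<open>p 0, \<dots>, p n\<close> matter.\<close>

definition geodesic_segment ::
  "('a, 'b) monoid_scheme \<Rightarrow> 'a set \<Rightarrow> 'a \<Rightarrow> 'a \<Rightarrow> (nat \<Rightarrow> 'a) \<Rightarrow> bool" where
  "geodesic_segment G S x y p \<longleftrightarrow>
     p 0 = x \<and> p (word_dist G S x y) = y \<and>
     (\<forall>i \<le> word_dist G S x y. p i \<in> carrier G) \<and>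
     (\<forall>i j. i \<le> j \<longrightarrow> j \<le> word_dist G S x y \<longrightarrow> word_dist G S (p i) (p j) = j - i)"

text \<open>Every geodesic triangle is \<open>\<delta>\<close>-slim. The condition is stated for one side of the triangle;
  the other two are covered by permuting \<open>x, y, z\<close> cyclically. Restricting to triangles with
  corners at vertices, and to vertices on their sides, only changes the value of \<open>\<delta>\<close>.\<close>

definition cayley_hyperbolic :: "('a, 'b) monoid_scheme \<Rightarrow> 'a set \<Rightarrow> real \<Rightarrow> bool" where
  "cayley_hyperbolic G S \<delta> \<longleftrightarrow>
     (\<forall>x \<in> carrier G. \<forall>y \<in> carrier G. \<forall>z \<in> carrier G. \<forall>p q r.
        geodesic_segment G S x y p \<longrightarrow> geodesic_segment G S y z q \<longrightarrow>
        geodesic_segment G S z x r \<longrightarrow>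
        (\<forall>i \<le> word_dist G S x y.
           (\<exists>j \<le> word_dist G S y z. real (word_dist G S (p i) (q j)) \<le> \<delta>) \<or>
           (\<exists>k \<le> word_dist G S z x. real (word_dist G S (p i) (r k)) \<le> \<delta>)))"

definition hyperbolic_group :: "('a, 'b) monoid_scheme \<Rightarrow> bool" where
  "hyperbolic_group G \<longleftrightarrow> group G \<and>
     (\<exists>S. finite_generating_set G S \<and> (\<exists>\<delta> \<ge> 0. cayley_hyperbolic G S \<delta>))"


section \<open>The Gromov boundary and the action of the automorphism group\<close>

text \<open>The basepoint of the Cayley graph is the identity element.\<close>

definition geodesic_rays :: "('a, 'b) monoid_scheme \<Rightarrow> 'a set \<Rightarrow> (nat \<Rightarrow> 'a) set" where
  "geodesic_rays G S = {\<gamma>. \<gamma> 0 = \<one>\<^bsub>G\<^esub> \<and> (\<forall>n. \<gamma> n \<in> carrier G) \<and>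
     (\<forall>i j. i \<le> j \<longrightarrow> word_dist G S (\<gamma> i) (\<gamma> j) = j - i)}"

definition ray_equiv :: "('a, 'b) monoid_scheme \<Rightarrow> 'a set \<Rightarrow> ((nat \<Rightarrow> 'a) \<times> (nat \<Rightarrow> 'a)) set" where
  "ray_equiv G S = {(\<gamma>, \<eta>). \<gamma> \<in> geodesic_rays G S \<and> \<eta> \<in> geodesic_rays G S \<and>
     (\<exists>C. \<forall>n. word_dist G S (\<gamma> n) (\<eta> n) \<le> C)}"

definition gromov_boundary :: "('a, 'b) monoid_scheme \<Rightarrow> 'a set \<Rightarrow> (nat \<Rightarrow> 'a) set set" where
  "gromov_boundary G S = geodesic_rays G S // ray_equiv G S"

definition finite_hausdorff_dist ::
  "('a, 'b) monoid_scheme \<Rightarrow> 'a set \<Rightarrow> 'a set \<Rightarrow> 'a set \<Rightarrow> bool" where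
  "finite_hausdorff_dist G S A B \<longleftrightarrow>
     (\<exists>C. (\<forall>a \<in> A. \<exists>b \<in> B. word_dist G S a b \<le> C) \<and>
          (\<forall>b \<in> B. \<exists>a \<in> A. word_dist G S a b \<le> C))"

text \<open>The boundary map induced by a quasi-isometry \<open>\<phi>\<close>: the class of a ray \<open>\<gamma>\<close> is sent to the
  endpoint of the quasi-geodesic ray \<open>\<phi> \<circ> \<gamma>\<close>, that is, to the class of the geodesic rays at
  finite Hausdorff distance from it. That this class is again a boundary point is
  a consequence of the stability of quasi-geodesics in hyperbolic spaces. The restriction to the
  boundary is there because the elements of \<^const>\<open>BijGroup\<close> are extensional functions.\<close>

definition boundary_action ::
  "('a, 'b) monoid_scheme \<Rightarrow> 'a set \<Rightarrow> ('a \<Rightarrow> 'a) \<Rightarrow> (nat \<Rightarrow> 'a) set \<Rightarrow> (nat \<Rightarrow> 'a) set" where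
  "boundary_action G S \<phi> = (\<lambda>\<xi> \<in> gromov_boundary G S.
     {\<eta> \<in> geodesic_rays G S. \<exists>\<gamma> \<in> \<xi>. finite_hausdorff_dist G S (range (\<phi> \<circ> \<gamma>)) (range \<eta>)})"

end

(* For an automorphism phi fixing the Gromov boundary pointwise and a homomorphism f to the integers
   with f(g) nonzero, the powers of g form a quasi-geodesic ray, because |n| <= |f(g^n)| is at most
   linear in the word length of g^n. By the Morse lemma it has an endpoint, which is also the endpoint
   of the powers of phi(g), and the pigeonhole principle in a ball gives phi(g)^m = g^n with
   m, n > 0. Hence f and f o phi have the same kernel and the same image, and they agree since
   m, n > 0. So m = n whenever f(g) is nonzero, and phi(g) = g because roots are unique in a
   residually torsion-free nilpotent group. Such g generate the group, since f is nonzero.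

   That f exists: in a nontrivial torsion-free nilpotent quotient take x in the last but one
   nontrivial term of the lower central series. The map y |-> [x, y] is a nontrivial homomorphism to
   the torsion-free centre (in the abelian case take the identity instead), and nontrivial finitely
   generated torsion-free abelian groups have nonzero homomorphisms to the integers.

   The given generating set need not be the one witnessing hyperbolicity. Its geodesics
   are quasi-geodesics for the latter, so fellow travelling can be proved there and carried over.
   Koenig's lemma then yields geodesic rays. *)
theory Submission
  imports Defs
begin

section \<open>Word metrics\<close>

text \<open>The boundary action sees a ray only up to finite Hausdorff distance, so rays, their
  images and sequences of powers are all compared as subsets. The Morse lemma rests on two competing
  growth rates: a geodesic lies within a logarithm of the length of a bilipschitz path with the same
  ends, while the argument at a point of the geodesic farthest from the path, at distance
  \<open>D\<close>, only involves lengths linear in \<open>D\<close>; so \<open>D\<close> is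
  bounded. That \<open>f \<circ> \<phi>\<close> vanishes where \<open>f\<close> does is obtained by
  applying commensurability to \<open>f \<circ> \<phi>\<close> itself. Surjectivity of
  \<open>\<phi>\<close> compares the images, and discreteness of the integers then gives equality of
  the two maps. Unique roots need factors that stay torsion-free. Those of the upper central series
  do, those of the lower one may acquire torsion, so nilpotency is first carried from the lower
  series to the upper one. Maps to the integers are built with rational values, where divisibility
  allows an extension by one generator at a time; denominators are cleared at the end.\<close>

locale word_metric = group G for G :: "('a, 'b) monoid_scheme" (structure) +
  fixes S :: "'a set"
  assumes gen: "finite_generating_set G S"
begin

abbreviation len :: "'a \<Rightarrow> nat" where "len \<equiv> word_length G S"
abbreviation d :: "'a \<Rightarrow> 'a \<Rightarrow> nat" where "d \<equiv> word_dist G S"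
abbreviation letters :: "'a set" where "letters \<equiv> S \<union> (\<lambda>s. inv s) ` S"
abbreviation wprod :: "'a list \<Rightarrow> 'a" where "wprod ws \<equiv> foldr (\<lambda>a b. a \<otimes> b) ws \<one>"

lemma S_carrier: "S \<subseteq> carrier G" and finite_S: "finite S" and generate_S: "generate G S = carrier G"
  using gen by (auto simp: finite_generating_set_def)

lemma letters_carrier: "letters \<subseteq> carrier G"
  using S_carrier by auto

lemma finite_letters: "finite letters"
  using finite_S by auto

lemma wprod_closed [simp]: "set ws \<subseteq> carrier G \<Longrightarrow> wprod ws \<in> carrier G"
  by (induction ws) auto

lemma wprod_append:
  "set xs \<subseteq> carrier G \<Longrightarrow> set ys \<subseteq> carrier G \<Longrightarrow> wprod (xs @ ys) = wprod xs \<otimes> wprod ys"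
  by (induction xs) (auto simp: m_assoc)

lemma wprod_rev_inv:
  "set xs \<subseteq> carrier G \<Longrightarrow> wprod (rev (map (\<lambda>x. inv x) xs)) = inv (wprod xs)"
proof (induction xs)
  case (Cons a xs)
  have "wprod (rev (map (\<lambda>x. inv x) (a # xs))) = wprod (rev (map (\<lambda>x. inv x) xs)) \<otimes> wprod [inv a]"
    using Cons.prems wprod_append[of "rev (map (\<lambda>x. inv x) xs)" "[inv a]"] by auto
  then show ?case
    using Cons by (simp add: inv_mult_group)
qed simp

lemma word_exists:
  assumes "g \<in> carrier G"
  shows "\<exists>ws. set ws \<subseteq> letters \<and> wprod ws = g"
proof -
  have "g \<in> generate G S" using assms generate_S by simp
  then show ?thesis
  proof induction
    case one
    show ?case by (rule exI[of _ "[]"]) simp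
  next
    case (incl h)
    then show ?case using S_carrier by (intro exI[of _ "[h]"]) auto
  next
    case (inv h)
    then show ?case using S_carrier by (intro exI[of _ "[inv h]"]) auto
  next
    case (eng h1 h2)
    then obtain u v where "set u \<subseteq> letters" "wprod u = h1" "set v \<subseteq> letters" "wprod v = h2"
      by auto
    then show ?case
      using letters_carrier wprod_append[of u v] by (intro exI[of _ "u @ v"]) auto
  qed
qed

lemma shortest_word:
  assumes "g \<in> carrier G"
  obtains ws where "set ws \<subseteq> letters" "length ws = len g" "wprod ws = g"
proof -
  have "\<exists>n ws. set ws \<subseteq> letters \<and> length ws = n \<and> wprod ws = g"
    using word_exists[OF assms] by blast
  from LeastI_ex[OF this] show ?thesis
    using that unfolding word_length_def by blast
qed

lemma len_wprod_le: "set ws \<subseteq> letters \<Longrightarrow> len (wprod ws) \<le> length ws"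
  unfolding word_length_def by (rule Least_le) auto

lemma len_one [simp]: "len \<one> = 0"
  using len_wprod_le[of "[]"] by simp

lemma len_mult_le:
  assumes "g \<in> carrier G" "h \<in> carrier G"
  shows "len (g \<otimes> h) \<le> len g + len h"
proof -
  obtain u v where "set u \<subseteq> letters" "length u = len g" "wprod u = g"
      "set v \<subseteq> letters" "length v = len h" "wprod v = h"
    using assms shortest_word by metis
  then show ?thesis
    using len_wprod_le[of "u @ v"] wprod_append[of u v] subset_trans[OF _ letters_carrier]
    by (metis Un_least length_append set_append)
qed

lemma len_inv_le:
  assumes "g \<in> carrier G"
  shows "len (inv g) \<le> len g"
proof -
  obtain u where u: "set u \<subseteq> letters" "length u = len g" "wprod u = g"
    using assms shortest_word by metis
  have "set (rev (map (\<lambda>x. inv x) u)) \<subseteq> letters"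
    using u(1) S_carrier by (force simp: subset_iff)
  from len_wprod_le[OF this] show ?thesis
    using u letters_carrier wprod_rev_inv[of u] by auto
qed

lemma len_inv [simp]: "g \<in> carrier G \<Longrightarrow> len (inv g) = len g"
  by (metis inv_closed inv_inv le_antisym len_inv_le)

text \<open>A maximum over the finitely many letters bounds \<open>h\<close> along any word. It is
  applied to the word length of a second generating set, to \<open>len (\<phi> g)\<close> and to the
  absolute value of an additive map to the integers.\<close>

lemma subadditive_le_len:
  fixes h :: "'a \<Rightarrow> nat"
  assumes "h \<one> = 0" "\<And>x y. x \<in> carrier G \<Longrightarrow> y \<in> carrier G \<Longrightarrow> h (x \<otimes> y) \<le> h x + h y"
  obtains K where "\<And>g. g \<in> carrier G \<Longrightarrow> h g \<le> K * len g"
proof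
  \<comment> \<open>The inserted 0 keeps the maximum defined when \<open>S\<close> is empty.\<close>
  define K where "K = Max (insert 0 (h ` letters))"
  have K: "h s \<le> K" if "s \<in> letters" for s
    unfolding K_def using that finite_letters by (intro Max_ge) auto
  have words: "h (wprod ws) \<le> K * length ws" if "set ws \<subseteq> letters" for ws
    using that
  proof (induction ws)
    case (Cons a ws)
    then have "h (a \<otimes> wprod ws) \<le> h a + h (wprod ws)"
      using letters_carrier by (intro assms(2) wprod_closed) auto
    then show ?case
      using Cons K[of a] by simp
  qed (use assms(1) in simp)
  show "h g \<le> K * len g" if "g \<in> carrier G" for g
    using shortest_word[OF that] words by metis
qed

lemma finite_ball: "finite {g \<in> carrier G. len g \<le> n}"
proof (rule finite_subset)
  show "{g \<in> carrier G. len g \<le> n} \<subseteq> wprod ` {ws. set ws \<subseteq> letters \<and> length ws \<le> n}"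
    by (smt (verit) image_eqI mem_Collect_eq shortest_word subsetI)
  show "finite (wprod ` {ws. set ws \<subseteq> letters \<and> length ws \<le> n})"
    by (intro finite_imageI finite_lists_length_le finite_letters)
qed

lemma d_self [simp]: "x \<in> carrier G \<Longrightarrow> d x x = 0"
  by (simp add: word_dist_def)

lemma d_commute: "x \<in> carrier G \<Longrightarrow> y \<in> carrier G \<Longrightarrow> d x y = d y x"
  by (metis inv_closed inv_inv inv_mult_group len_inv m_closed word_dist_def)

lemma d_triangle:
  assumes "x \<in> carrier G" "y \<in> carrier G" "z \<in> carrier G"
  shows "d x z \<le> d x y + d y z"
proof -
  have "inv x \<otimes> z = (inv x \<otimes> y) \<otimes> (inv y \<otimes> z)"
    using assms by (metis inv_closed inv_solve_left m_assoc m_closed)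
  then show ?thesis
    using assms len_mult_le unfolding word_dist_def by simp
qed

lemma d_one_left: "x \<in> carrier G \<Longrightarrow> d \<one> x = len x"
  by (simp add: word_dist_def)

lemma finite_d_ball:
  assumes "x \<in> carrier G"
  shows "finite {y \<in> carrier G. d x y \<le> n}"
proof (rule finite_subset)
  show "{y \<in> carrier G. d x y \<le> n} \<subseteq> (\<lambda>g. x \<otimes> g) ` {g \<in> carrier G. len g \<le> n}"
  proof
    fix y assume y: "y \<in> {y \<in> carrier G. d x y \<le> n}"
    then have "y = x \<otimes> (inv x \<otimes> y)"
      using assms by (simp add: m_assoc[symmetric])
    then show "y \<in> (\<lambda>g. x \<otimes> g) ` {g \<in> carrier G. len g \<le> n}"
      using y assms by (intro image_eqI[of _ _ "inv x \<otimes> y"]) (auto simp: word_dist_def)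
  qed
qed (use finite_ball in simp)

subsection \<open>Geodesics\<close>

text \<open>The vertices are \<open>x\<close> times the prefixes of a shortest word for
  \<open>inv x \<otimes> y\<close>.\<close>

lemma geodesic_exists:
  assumes "x \<in> carrier G" "y \<in> carrier G"
  obtains p where "geodesic_segment G S x y p"
proof -
  obtain ws where ws: "set ws \<subseteq> letters" "length ws = len (inv x \<otimes> y)" "wprod ws = inv x \<otimes> y"
    using assms shortest_word by (metis inv_closed m_closed)
  define p where "p i = x \<otimes> wprod (take i ws)" for i
  have cl: "set us \<subseteq> letters \<Longrightarrow> wprod us \<in> carrier G" for us
    using letters_carrier by auto
  have tk: "set (take i ws) \<subseteq> letters" for i
    using ws(1) set_take_subset by fastforce
  have pc: "p i \<in> carrier G" for i
    unfolding p_def using assms cl[OF tk] by simp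
  have le: "d (p i) (p j) \<le> j - i" if "i \<le> j" for i j
  proof -
    define u where "u = take (j - i) (drop i ws)"
    have "take j ws = take i ws @ u"
      unfolding u_def using that by (metis le_add_diff_inverse take_add)
    moreover have u: "set u \<subseteq> letters"
      unfolding u_def using ws(1) by (meson order_trans set_drop_subset set_take_subset)
    ultimately have "p j = p i \<otimes> wprod u"
      unfolding p_def using assms wprod_append[of "take i ws" u] tk[of i] letters_carrier cl
      by (simp add: m_assoc subset_trans)
    then have "inv (p i) \<otimes> p j = wprod u"
      using pc cl[OF u] by (simp add: m_assoc[symmetric])
    then show ?thesis
      unfolding word_dist_def using len_wprod_le[OF u] by (simp add: u_def)
  qed
  have p0: "p 0 = x" and pn: "p (d x y) = y"
    unfolding p_def word_dist_def using assms ws by (simp_all add: m_assoc[symmetric])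
  have "geodesic_segment G S x y p"
    unfolding geodesic_segment_def
  proof (intro conjI allI impI)
    fix i j assume ij: "i \<le> j" "j \<le> d x y"
    \<comment> \<open>Subwords give upper bounds only. They are attained, since otherwise the route
      through \<open>p i\<close> and \<open>p j\<close> would be shorter than
      \<open>d x y\<close>.\<close>
    have "d x y \<le> d x (p i) + d (p i) (p j) + d (p j) y"
      using d_triangle[of x "p i" y] d_triangle[of "p i" "p j" y] pc assms by simp
    moreover have "d x (p i) \<le> i" "d (p j) y \<le> d x y - j"
      using le[of 0 i] le[of j "d x y"] ij p0 pn by auto
    ultimately show "d (p i) (p j) = j - i"
      using le[OF ij(1)] ij by simp
  qed (use p0 pn pc in auto)
  then show ?thesis by (rule that)
qed

lemma geodesicD:
  assumes "geodesic_segment G S x y p"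
  shows "p 0 = x" "p (d x y) = y" "x \<in> carrier G" "y \<in> carrier G"
    "i \<le> d x y \<Longrightarrow> p i \<in> carrier G"
    "i \<le> j \<Longrightarrow> j \<le> d x y \<Longrightarrow> d (p i) (p j) = j - i"
  using assms unfolding geodesic_segment_def by (metis le0 le_refl)+

lemma geodesic_rev:
  assumes "geodesic_segment G S x y p"
  shows "geodesic_segment G S y x (\<lambda>i. p (d x y - i))"
proof -
  note g = geodesicD[OF assms]
  have yx: "d y x = d x y" using g d_commute by simp
  have "d (p (d x y - i)) (p (d x y - j)) = j - i" if "i \<le> j" "j \<le> d x y" for i j
    using g(6)[of "d x y - j" "d x y - i"] that d_commute g(5) by simp
  then show ?thesis
    unfolding geodesic_segment_def yx using g by auto
qed

lemma geodesic_sub: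
  assumes "geodesic_segment G S x y p" "a \<le> b" "b \<le> d x y"
  shows "geodesic_segment G S (p a) (p b) (\<lambda>i. p (a + i))"
  using geodesicD[OF assms(1)] assms(2,3) unfolding geodesic_segment_def by auto

subsection \<open>Bilipschitz discrete paths\<close>

text \<open>A quasi-geodesic condition with multiplicative bounds only, which geodesics, powers of
  suitable elements and automorphic images of rays all satisfy. The index set is
  \<open>{..N}\<close> for finite paths and \<open>UNIV\<close> for rays.\<close>

definition bilip :: "nat \<Rightarrow> nat set \<Rightarrow> (nat \<Rightarrow> 'a) \<Rightarrow> bool" where
  "bilip K I c \<longleftrightarrow> (\<forall>i\<in>I. c i \<in> carrier G) \<and>
     (\<forall>i\<in>I. \<forall>j\<in>I. i \<le> j \<longrightarrow> d (c i) (c j) \<le> K * (j - i) \<and> j - i \<le> K * d (c i) (c j))"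

lemma bilipD:
  assumes "bilip K I c" "i \<in> I"
  shows "c i \<in> carrier G"
    "j \<in> I \<Longrightarrow> i \<le> j \<Longrightarrow> d (c i) (c j) \<le> K * (j - i)"
    "j \<in> I \<Longrightarrow> i \<le> j \<Longrightarrow> j - i \<le> K * d (c i) (c j)"
  using assms unfolding bilip_def by auto

lemma bilip_mono: "bilip K I c \<Longrightarrow> K \<le> K' \<Longrightarrow> J \<subseteq> I \<Longrightarrow> bilip K' J c"
  unfolding bilip_def by (meson le_trans mult_le_mono1 subsetD)

lemma bilip_geodesic: "geodesic_segment G S x y p \<Longrightarrow> bilip 1 {..d x y} p"
  unfolding bilip_def using geodesicD by auto

end

section \<open>Stability of quasi-geodesics\<close>

locale hyperbolic_metric = word_metric +
  fixes \<delta> :: nat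
  assumes hyp: "cayley_hyperbolic G S (real \<delta>)"
begin

text \<open>Re-orients the triangle: \<open>cayley_hyperbolic\<close> runs the sides cyclically,
  whereas here \<open>q\<close> and \<open>r\<close> lead from \<open>x\<close> through
  \<open>z\<close> to \<open>y\<close>, so both are reversed.\<close>

lemma slim:
  assumes p: "geodesic_segment G S x y p" and q: "geodesic_segment G S x z q"
    and r: "geodesic_segment G S z y r" and i: "i \<le> d x y"
  shows "(\<exists>j\<le>d x z. d (p i) (q j) \<le> \<delta>) \<or> (\<exists>j\<le>d z y. d (p i) (r j) \<le> \<delta>)"
proof -
  note P = geodesicD[OF p] and Q = geodesicD[OF q]
  have "(\<exists>j\<le>d y z. d (p i) (r (d z y - j)) \<le> \<delta>) \<or> (\<exists>j\<le>d z x. d (p i) (q (d x z - j)) \<le> \<delta>)"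
    using hyp[unfolded cayley_hyperbolic_def, rule_format, OF P(3,4) Q(4) p geodesic_rev[OF r]
        geodesic_rev[OF q] i] by simp
  then show ?thesis by (meson diff_le_self)
qed

text \<open>A diagonal cuts the quadrilateral into two slim triangles, at a cost of
  \<open>\<delta>\<close> each.\<close>

lemma slim_quadrilateral:
  assumes p: "geodesic_segment G S x y p" and a: "geodesic_segment G S x x' a"
    and b: "geodesic_segment G S x' y' b" and e: "geodesic_segment G S y' y e" and i: "i \<le> d x y"
  shows "(\<exists>j\<le>d x x'. d (p i) (a j) \<le> 2 * \<delta>) \<or> (\<exists>j\<le>d x' y'. d (p i) (b j) \<le> 2 * \<delta>)
    \<or> (\<exists>j\<le>d y' y. d (p i) (e j) \<le> 2 * \<delta>)"
proof -
  obtain q where q: "geodesic_segment G S x' y q"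
    using geodesic_exists geodesicD(4)[OF a] geodesicD(4)[OF e] by blast
  consider j where "j \<le> d x x'" "d (p i) (a j) \<le> \<delta>" | j where "j \<le> d x' y" "d (p i) (q j) \<le> \<delta>"
    using slim[OF p a q i] by blast
  then show ?thesis
  proof cases
    case (1 j)
    then have "d (p i) (a j) \<le> 2 * \<delta>" by linarith
    then show ?thesis using 1(1) by blast
  next
    case (2 j)
    have tri: "d (p i) u \<le> 2 * \<delta>" if "d (q j) u \<le> \<delta>" "u \<in> carrier G" for u
      using d_triangle[of "p i" "q j" u] that 2 geodesicD(5)[OF q 2(1)] geodesicD(5)[OF p i] by simp
    show ?thesis
      using slim[OF q b e 2(1)] tri geodesicD(5)[OF b] geodesicD(5)[OF e] by blast
  qed
qed

text \<open>Bisecting the index interval costs one slim triangle, hence \<open>\<delta>\<close>, and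
  halves the number of steps. After \<open>k\<close> bisections at most one step is left, of length
  at most \<open>K\<close>, so the bound is logarithmic in the number of steps.\<close>

lemma geodesic_near_short_path:
  assumes "m \<le> n" "n - m \<le> 2 ^ k" "\<And>i. i \<in> {m..n} \<Longrightarrow> c i \<in> carrier G"
    and "\<And>i. i \<in> {m..<n} \<Longrightarrow> d (c i) (c (Suc i)) \<le> K"
    and "geodesic_segment G S (c m) (c n) p" "i \<le> d (c m) (c n)"
  shows "\<exists>j\<in>{m..n}. d (p i) (c j) \<le> \<delta> * k + K"
  using assms
proof (induction k arbitrary: m n p i)
  case 0
  note g = geodesicD[OF 0(5)]
  have "d (c m) (c n) \<le> K"
  proof (cases "m = n")
    case False
    then have "n = Suc m" using 0 by simp
    then show ?thesis using 0(4)[of m] by simp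
  qed (use g in simp)
  then have "d (p i) (c n) \<le> K"
    using g(6)[of i "d (c m) (c n)"] g(2) 0(6) by simp
  then show ?case using 0(1) by force
next
  case (Suc k)
  note g = geodesicD[OF Suc(6)]
  define l where "l = (m + n) div 2"
  have l: "m \<le> l" "l \<le> n" "l - m \<le> 2 ^ k" "n - l \<le> 2 ^ k"
    using Suc(2,3) unfolding l_def by auto
  have cl: "c l \<in> carrier G" using Suc(4) l by simp
  obtain q r where q: "geodesic_segment G S (c m) (c l) q" and r: "geodesic_segment G S (c l) (c n) r"
    using geodesic_exists cl g(3,4) by meson
  have step: "\<exists>j\<in>{m..n}. d (p i) (c j) \<le> \<delta> * Suc k + K"
    if "d (p i) u \<le> \<delta>" "u \<in> carrier G" "\<exists>j\<in>{m..n}. d u (c j) \<le> \<delta> * k + K" for u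
  proof -
    from that obtain j where j: "j \<in> {m..n}" "d u (c j) \<le> \<delta> * k + K" by blast
    have "d (p i) (c j) \<le> d (p i) u + d u (c j)"
      using that Suc(4)[OF j(1)] g(5)[OF Suc(7)] by (intro d_triangle) auto
    then have "d (p i) (c j) \<le> \<delta> * Suc k + K" using that(1) j(2) by simp
    then show ?thesis using j(1) by blast
  qed
  from slim[OF Suc(6) q r Suc(7)] show ?case
  proof (elim disjE exE conjE)
    fix j assume j: "j \<le> d (c m) (c l)" "d (p i) (q j) \<le> \<delta>"
    have "\<exists>i\<in>{m..l}. d (q j) (c i) \<le> \<delta> * k + K"
      by (rule Suc.IH[OF l(1,3) _ _ q j(1)]) (use Suc(4,5) l in auto)
    then show ?thesis
      using j l geodesicD(5)[OF q] by (intro step[of "q j"]) auto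
  next
    fix j assume j: "j \<le> d (c l) (c n)" "d (p i) (r j) \<le> \<delta>"
    have "\<exists>i\<in>{l..n}. d (r j) (c i) \<le> \<delta> * k + K"
      by (rule Suc.IH[OF l(2,4) _ _ r j(1)]) (use Suc(4,5) l in auto)
    then show ?thesis
      using j l geodesicD(5)[OF r] by (intro step[of "r j"]) auto
  qed
qed

end

context hyperbolic_metric
begin

text \<open>The lower bilipschitz bound turns the distance of the ends into a bound on the number of
  steps. In the application \<open>m\<close> and \<open>n\<close> are indices of nearby path points
  and may come in either order.\<close>

lemma geodesic_near_bilip_subpath:
  assumes c: "bilip K {..N} c" and "m \<le> N" "n \<le> N" and k: "K * d (c m) (c n) \<le> 2 ^ k"
    and p: "geodesic_segment G S (c m) (c n) p" and i: "i \<le> d (c m) (c n)"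
  shows "\<exists>j\<le>N. d (p i) (c j) \<le> \<delta> * k + K"
proof -
  note cc = bilipD[OF c]
  have main: "\<exists>j\<le>N. d (q i) (c j) \<le> \<delta> * k + K"
    if mn: "m \<le> n" "n \<le> N" "K * d (c m) (c n) \<le> 2 ^ k" and q: "geodesic_segment G S (c m) (c n) q"
      and i: "i \<le> d (c m) (c n)" for m n q i
  proof -
    have "\<exists>j\<in>{m..n}. d (q i) (c j) \<le> \<delta> * k + K"
    proof (rule geodesic_near_short_path[OF mn(1) _ _ _ q i])
      show "n - m \<le> 2 ^ k" using cc(3)[of m n] mn by simp
      show "c i \<in> carrier G" if "i \<in> {m..n}" for i using that mn cc(1)[of i] by simp
      show "d (c i) (c (Suc i)) \<le> K" if "i \<in> {m..<n}" for i
        using that mn cc(2)[of i "Suc i"] by simp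
    qed
    then obtain j where "j \<in> {m..n}" "d (q i) (c j) \<le> \<delta> * k + K" by blast
    then show ?thesis using mn(2) by (intro exI[of _ j]) auto
  qed
  show ?thesis
  proof (cases "m \<le> n")
    case True
    then show ?thesis using main assms by blast
  next
    case False
    have eq: "d (c n) (c m) = d (c m) (c n)"
      using d_commute cc(1) assms(2,3) by simp
    have "\<exists>j\<le>N. d (p (d (c m) (c n) - (d (c m) (c n) - i))) (c j) \<le> \<delta> * k + K"
      by (rule main[OF _ _ _ geodesic_rev[OF p]]) (use False assms eq in auto)
    then show ?thesis using i by simp
  qed
qed

section \<open>Logarithmic versus linear growth\<close>

lemma linear_le_exp: "\<exists>k0. \<forall>k\<ge>k0. M * (k + 1) \<le> (2::nat) ^ k"
proof -
  have base: "M * (2 * M + 3) \<le> 2 ^ (2 * M + 2)" proof (induction M)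
    case (Suc M)
    have "2 * M + 1 \<le> 2 ^ (2 * M)" using less_exp[of "2 * M"] by linarith
    then show ?case using Suc by (simp add: algebra_simps)
  qed simp
  have "M * (k + 1) \<le> 2 ^ k" if "2 * M + 2 \<le> k" for k
    using that
  proof (induction k rule: dec_induct)
    case (step n)
    have "M * (Suc n + 1) \<le> 2 * (M * (n + 1))" by (simp add: algebra_simps)
    then show ?case using step by simp
  qed (use base in \<open>simp add: algebra_simps\<close>)
  then show ?thesis by blast
qed

text \<open>\<open>6 * D\<close> is the length bound for the quadrilateral side in
  \<open>geodesic_near_bilip\<close> that joins two path points. For large \<open>D\<close> its
  logarithm, scaled by \<open>\<delta>\<close>, stays below \<open>D\<close>.\<close>

lemma log_bound:
  obtains D0 where "\<And>D. D > D0 \<Longrightarrow> \<exists>k. K * (6 * D) \<le> 2 ^ k \<and> 2 * \<delta> + (\<delta> * k + K) < D"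
proof -
  \<comment> \<open>With \<open>k = D div b\<close> the coefficient 2 keeps
    \<open>\<delta> * k\<close> below or at half of \<open>D\<close>; the summand 2 makes
    \<open>b\<close> positive for \<open>\<delta> = 0\<close>.\<close>
  define b where "b = 2 * \<delta> + 2"
  obtain k0 where k0: "\<And>k. k \<ge> k0 \<Longrightarrow> 6 * K * b * (k + 1) \<le> 2 ^ k"
    using linear_le_exp by blast
  \<comment> \<open>In the threshold \<open>b * k0\<close> ensures \<open>k \<ge> k0\<close>, and
    the rest puts \<open>2 * \<delta> + K\<close> below half of \<open>D\<close>.\<close>
  have "\<exists>k. K * (6 * D) \<le> 2 ^ k \<and> 2 * \<delta> + (\<delta> * k + K) < D" if D: "D > b * k0 + 4 * \<delta> + 2 * K" for D
  proof (intro exI conjI)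
    define k where "k = D div b"
    have b: "b > 0" unfolding b_def by simp
    have "k \<ge> k0"
      unfolding k_def using D b by (simp add: less_eq_div_iff_mult_less_eq mult.commute)
    then have "6 * K * b * (k + 1) \<le> 2 ^ k" by (rule k0)
    moreover have "D \<le> b * (k + 1)"
      unfolding k_def using b dividend_less_times_div[of b D] by simp
    then have "6 * K * D \<le> 6 * K * b * (k + 1)" unfolding mult.assoc by (intro mult_le_mono2)
    ultimately have "6 * K * D \<le> 2 ^ k" by linarith
    then show "K * (6 * D) \<le> 2 ^ (D div b)"
      unfolding k_def by (simp add: ac_simps)
    have "k * b \<le> D" unfolding k_def by simp
    then have "2 * (\<delta> * k) \<le> D" unfolding b_def by (simp add: algebra_simps)
    then show "2 * \<delta> + (\<delta> * (D div b) + K) < D"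
      using D unfolding k_def[symmetric] by linarith
  qed
  then show ?thesis using that by blast
qed

text \<open>Take the point of the geodesic farthest from the path, at distance \<open>D\<close>, go
  \<open>2 * D\<close> along the geodesic to both sides and from there across to the path. For large
  \<open>D\<close> only the side between the two path points can come within
  \<open>2 * \<delta>\<close> of the farthest point, and the logarithmic bound then brings the path
  closer than \<open>D\<close>, a contradiction.\<close>

lemma geodesic_near_bilip:
  obtains D where "\<And>N c p i. bilip K {..N} c \<Longrightarrow> geodesic_segment G S (c 0) (c N) p \<Longrightarrow>
    i \<le> d (c 0) (c N) \<Longrightarrow> \<exists>j\<le>N. d (p i) (c j) \<le> D"
proof -
  obtain D0 where D0: "\<And>D. D > D0 \<Longrightarrow> \<exists>k. K * (6 * D) \<le> 2 ^ k \<and> 2 * \<delta> + (\<delta> * k + K) < D"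
    using log_bound by blast
  have "\<exists>j\<le>N. d (p i) (c j) \<le> D0" if c: "bilip K {..N} c"
    and p: "geodesic_segment G S (c 0) (c N) p" and i: "i \<le> d (c 0) (c N)" for N c p i
  proof -
    note cc = bilipD[OF c] and P = geodesicD[OF p]
    define n where "n = d (c 0) (c N)"
    define f where "f i = Min ((\<lambda>j. d (p i) (c j)) ` {..N})" for i
    have f_le: "f i \<le> d (p i) (c j)" if "j \<le> N" for i j
      unfolding f_def using that by (intro Min_le) auto
    have f_ex: "\<exists>j\<le>N. d (p i) (c j) = f i" for i
    proof -
      have "f i \<in> (\<lambda>j. d (p i) (c j)) ` {..N}"
        unfolding f_def by (rule Min_in) auto
      then show ?thesis by auto
    qed
    define D where "D = Max (f ` {..n})"
    have D_ge: "f i \<le> D" if "i \<le> n" for i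
      unfolding D_def using that by (intro Max_ge) auto
    have "D \<in> f ` {..n}" unfolding D_def by (rule Max_in) auto
    then obtain i0 where i0: "i0 \<le> n" "f i0 = D" by auto
    have "D \<le> D0"
    proof (rule ccontr)
      assume "\<not> D \<le> D0"
      then obtain k where k: "K * (6 * D) \<le> 2 ^ k" "2 * \<delta> + (\<delta> * k + K) < D"
        using D0[of D] by auto
      \<comment> \<open>At an end of the geodesic the end of the path itself is chosen, so that the
        crossing side there is degenerate.\<close>
      have near: "\<exists>j\<le>N. d (p a) (c j) \<le> D \<and> (a = 0 \<or> a = n \<longrightarrow> c j = p a)" if "a \<le> n" for a
      proof -
        consider "a = 0" | "a = n" | "a \<noteq> 0" "a \<noteq> n" by blast
        then show ?thesis
        proof cases
          case 1
          then show ?thesis using P by (intro exI[of _ 0]) simp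
        next
          case 2
          then show ?thesis using P unfolding n_def by (intro exI[of _ N]) simp
        next
          case 3
          then show ?thesis using f_ex[of a] D_ge[OF that] by auto
        qed
      qed
      \<comment> \<open>Truncated subtraction and \<open>min\<close> stop at the ends of the
        geodesic when less than \<open>2 * D\<close> of room is left.\<close>
      define a b where "a = i0 - 2 * D" and "b = min n (i0 + 2 * D)"
      have ab: "a \<le> i0" "i0 \<le> b" "b \<le> n" unfolding a_def b_def using i0 by auto
      obtain ja where ja: "ja \<le> N" "d (p a) (c ja) \<le> D" "a = 0 \<Longrightarrow> c ja = p a"
        using near[of a] ab by auto
      obtain jb where jb: "jb \<le> N" "d (p b) (c jb) \<le> D" "b = n \<Longrightarrow> c jb = p b"
        using near[of b] ab by auto
      have pc: "p a \<in> carrier G" "p b \<in> carrier G" "p i0 \<in> carrier G"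
        using P(5) ab unfolding n_def by auto
      have cj: "c ja \<in> carrier G" "c jb \<in> carrier G" using cc(1) ja(1) jb(1) by auto
      obtain qa q qb where qa: "geodesic_segment G S (p a) (c ja) qa"
        and q: "geodesic_segment G S (c ja) (c jb) q"
        and qb: "geodesic_segment G S (c jb) (p b) qb"
        using geodesic_exists pc cj by metis
      have dab: "d (p a) (p b) = b - a" using P(6)[of a b] ab unfolding n_def by simp
      have "d (c ja) (c jb) \<le> d (c ja) (p a) + d (p a) (p b) + d (p b) (c jb)"
        using d_triangle[of "c ja" "p a" "c jb"] d_triangle[of "p a" "p b" "c jb"] pc cj by simp
      \<comment> \<open>The three parts are at most \<open>D\<close>, \<open>4 * D\<close> and
        \<open>D\<close>.\<close>
      then have "d (c ja) (c jb) \<le> 6 * D"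
        using ja(2) jb(2) dab d_commute[OF pc(1) cj(1)] unfolding a_def b_def by linarith
      then have k': "K * d (c ja) (c jb) \<le> 2 ^ k"
        using k(1) le_trans mult_le_mono2 by blast
      have far: False if "d (p i0) (c j) < D" "j \<le> N" for j
        using f_le[OF that(2), of i0] that(1) i0 by simp
      \<comment> \<open>A point of a side leading from an endpoint \<open>v\<close> at distance \<open>2 D\<close> of \<open>p i0\<close> to the path is
        at distance at least \<open>D\<close> from \<open>p i0\<close>.\<close>
      have side: False if "d (p i0) u \<le> 2 * \<delta>" "u \<in> carrier G" "v \<in> carrier G" "d v u \<le> D"
        "d v (p i0) = 2 * D" for u v
        using d_triangle[of v u "p i0"] d_commute[of u "p i0"] that pc k(2) by linarith
      have "i0 - a \<le> d (p a) (p b)" using dab ab by simp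
      from slim_quadrilateral[OF geodesic_sub[OF p, folded n_def, of a b] qa q qb this] ab
      have "(\<exists>j\<le>d (p a) (c ja). d (p i0) (qa j) \<le> 2 * \<delta>)
        \<or> (\<exists>j\<le>d (c ja) (c jb). d (p i0) (q j) \<le> 2 * \<delta>)
        \<or> (\<exists>j\<le>d (c jb) (p b). d (p i0) (qb j) \<le> 2 * \<delta>)" by simp
      then show False
      proof (elim disjE exE conjE)
        fix j assume j: "j \<le> d (p a) (c ja)" "d (p i0) (qa j) \<le> 2 * \<delta>"
        show False
        proof (cases "a = 0")
          case True
          then have "qa j = c ja" using geodesicD[OF qa] j ja by simp
          then show False using far[of ja] j ja k by simp
        next
          case False
          then have "d (p a) (p i0) = 2 * D"
            using P(6)[of a i0] ab i0 unfolding n_def a_def by simp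
          moreover have "d (p a) (qa j) \<le> D"
            using geodesicD(1)[OF qa] geodesicD(6)[OF qa, of 0 j] j ja(2) by simp
          ultimately show False
            using side[of "qa j" "p a"] j geodesicD(5)[OF qa] pc by blast
        qed
      next
        fix j assume j: "j \<le> d (c jb) (p b)" "d (p i0) (qb j) \<le> 2 * \<delta>"
        show False
        proof (cases "b = n")
          case True
          then have "qb j = c jb" using geodesicD[OF qb] j jb by simp
          then show False using far[of jb] j jb k by simp
        next
          case False
          then have "d (p i0) (p b) = 2 * D"
            using P(6)[of i0 b] ab i0 unfolding n_def b_def by simp
          then have "d (p b) (p i0) = 2 * D" using d_commute pc by simp
          moreover have "d (qb j) (p b) \<le> D"
            using geodesicD(2)[OF qb] geodesicD(6)[OF qb, of j "d (c jb) (p b)"] j jb(2)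
              d_commute[OF pc(2) cj(2)] by simp
          then have "d (p b) (qb j) \<le> D"
            using d_commute[OF pc(2) geodesicD(5)[OF qb j(1)]] by simp
          ultimately show False
            using side[of "qb j" "p b"] j geodesicD(5)[OF qb] pc by blast
        qed
      next
        fix j assume j: "j \<le> d (c ja) (c jb)" "d (p i0) (q j) \<le> 2 * \<delta>"
        obtain l where l: "l \<le> N" "d (q j) (c l) \<le> \<delta> * k + K"
          using geodesic_near_bilip_subpath[OF c ja(1) jb(1) k' q j(1)] by blast
        have "d (p i0) (c l) \<le> 2 * \<delta> + (\<delta> * k + K)"
          using d_triangle[of "p i0" "q j" "c l"] pc geodesicD(5)[OF q j(1)] cc(1)[of l] l j by simp
        then show False using far[OF _ l(1)] k(2) by simp
      qed
    qed
    then show ?thesis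
      using f_ex[of i] D_ge[of i] i unfolding n_def by (metis le_trans)
  qed
  then show ?thesis using that by blast
qed

text \<open>Discrete intermediate values: \<open>f\<close> may jump and need not be monotone, but
  some step passes over \<open>t\<close>. The alternative \<open>f n = t\<close> covers
  \<open>n = 0\<close>.\<close>

lemma discrete_crossing:
  fixes f :: "nat \<Rightarrow> nat"
  assumes "f 0 \<le> t" "t \<le> f n"
  shows "f n = t \<or> (\<exists>i<n. f i \<le> t \<and> t \<le> f (Suc i))"
  using assms by (induction n) (auto, metis le_cases less_Suc_eq)

text \<open>The converse inclusion. Each geodesic point is assigned the index of a nearby path
  point; indices of consecutive points differ boundedly because the path is bilipschitz, so they
  cannot jump over \<open>t\<close> by much.\<close>

lemma bilip_near_geodesic:
  obtains D where "\<And>N c p t. bilip K {..N} c \<Longrightarrow> geodesic_segment G S (c 0) (c N) p \<Longrightarrow>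
    t \<le> N \<Longrightarrow> \<exists>i\<le>d (c 0) (c N). d (c t) (p i) \<le> D"
proof -
  obtain D where D: "\<And>N c p i. bilip K {..N} c \<Longrightarrow> geodesic_segment G S (c 0) (c N) p \<Longrightarrow>
    i \<le> d (c 0) (c N) \<Longrightarrow> \<exists>j\<le>N. d (p i) (c j) \<le> D"
    using geodesic_near_bilip by blast
  \<comment> \<open>Path points assigned to neighbours are within \<open>2 * D + 1\<close>, their
    indices within \<open>K * (2 * D + 1)\<close>. A further factor \<open>K\<close> returns to
    distances, and \<open>D\<close> leads to the geodesic.\<close>
  have "\<exists>i\<le>d (c 0) (c N). d (c t) (p i) \<le> K * (K * (2 * D + 1)) + D"
    if c: "bilip K {..N} c" and p: "geodesic_segment G S (c 0) (c N) p" and t: "t \<le> N" for N c p t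
  proof -
    note cc = bilipD[OF c] and P = geodesicD[OF p]
    define n where "n = d (c 0) (c N)"
    \<comment> \<open>The assigned indices have to run from \<open>0\<close> to \<open>N\<close>;
      the guard \<open>i \<noteq> 0\<close> keeps the two requirements compatible for
      \<open>n = 0\<close>.\<close>
    have "\<exists>j\<le>N. d (p i) (c j) \<le> D \<and> (i = 0 \<longrightarrow> j = 0) \<and> (i = n \<and> i \<noteq> 0 \<longrightarrow> j = N)" if "i \<le> n" for i
    proof -
      consider "i = 0" | "i = n" "i \<noteq> 0" | "i \<noteq> 0" "i \<noteq> n" by blast
      then show ?thesis
      proof cases
        case 1
        then show ?thesis using P by (intro exI[of _ 0]) simp
      next
        case 2
        then show ?thesis using P unfolding n_def by (intro exI[of _ N]) simp
      next
        case 3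
        then show ?thesis using D[OF c p] that unfolding n_def by simp
      qed
    qed
    then obtain f where f: "\<And>i. i \<le> n \<Longrightarrow> f i \<le> N" "\<And>i. i \<le> n \<Longrightarrow> d (p i) (c (f i)) \<le> D"
      and f0: "f 0 = 0" and fn: "n \<noteq> 0 \<Longrightarrow> f n = N"
      by (metis le0 order_refl)
    show ?thesis
    proof (cases "n = 0")
      case True
      then have "N = 0" using cc(3)[of 0 N] unfolding n_def by simp
      then show ?thesis using t P by (intro exI[of _ 0]) simp
    next
      case False
      then consider "t = N" | i where "i < n" "f i \<le> t" "t \<le> f (Suc i)"
        using discrete_crossing[of f t n] f0 fn t by auto
      then show ?thesis
      proof cases
        case 1
        then show ?thesis using P by (intro exI[of _ "d (c 0) (c N)"]) simp
      next
        case 2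
        have pc: "p i \<in> carrier G" "p (Suc i) \<in> carrier G" using P(5) 2 unfolding n_def by auto
        have fi: "f i \<le> N" "f (Suc i) \<le> N" using f(1) 2 by auto
        have cf: "c (f i) \<in> carrier G" "c (f (Suc i)) \<in> carrier G" "c t \<in> carrier G"
          using cc(1) fi t by auto
        have "d (p i) (p (Suc i)) = 1" using P(6)[of i "Suc i"] 2 unfolding n_def by simp
        moreover have "d (c (f i)) (c (f (Suc i)))
            \<le> d (c (f i)) (p i) + d (p i) (p (Suc i)) + d (p (Suc i)) (c (f (Suc i)))"
          using d_triangle[of "c (f i)" "p i" "c (f (Suc i))"]
            d_triangle[of "p i" "p (Suc i)" "c (f (Suc i))"] pc cf by simp
        ultimately have "d (c (f i)) (c (f (Suc i))) \<le> 2 * D + 1"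
          using f(2)[of i] f(2)[of "Suc i"] 2(1) d_commute[OF pc(1) cf(1)] by simp
        then have "f (Suc i) - f i \<le> K * (2 * D + 1)"
          using cc(3)[of "f i" "f (Suc i)"] fi 2 by (meson atMost_iff le_trans mult_le_mono2)
        then have "t - f i \<le> K * (2 * D + 1)" using 2 by linarith
        then have "d (c (f i)) (c t) \<le> K * (K * (2 * D + 1))"
          using cc(2)[of "f i" t] fi 2 t by (meson atMost_iff le_trans mult_le_mono2)
        then have "d (c t) (p i) \<le> K * (K * (2 * D + 1)) + D"
          using d_triangle[of "c t" "c (f i)" "p i"] f(2)[of i] 2(1) pc cf d_commute by fastforce
        then show ?thesis using 2(1) unfolding n_def by (intro exI[of _ i]) simp
      qed
    qed
  qed
  then show ?thesis using that by blast
qed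

text \<open>A common geodesic mediates between the two paths. It no longer occurs in the statement,
  which therefore survives a change of generators.\<close>

theorem bilip_fellow_travel:
  obtains D where "\<And>N c N' c' t. bilip K {..N} c \<Longrightarrow> bilip K {..N'} c' \<Longrightarrow> c 0 = c' 0 \<Longrightarrow>
    c N = c' N' \<Longrightarrow> t \<le> N \<Longrightarrow> \<exists>s\<le>N'. d (c t) (c' s) \<le> D"
proof -
  obtain D1 where D1: "\<And>N c p i. bilip K {..N} c \<Longrightarrow> geodesic_segment G S (c 0) (c N) p \<Longrightarrow>
    i \<le> d (c 0) (c N) \<Longrightarrow> \<exists>j\<le>N. d (p i) (c j) \<le> D1"
    using geodesic_near_bilip by blast
  obtain D2 where D2: "\<And>N c p t. bilip K {..N} c \<Longrightarrow> geodesic_segment G S (c 0) (c N) p \<Longrightarrow>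
    t \<le> N \<Longrightarrow> \<exists>i\<le>d (c 0) (c N). d (c t) (p i) \<le> D2"
    using bilip_near_geodesic by blast
  have "\<exists>s\<le>N'. d (c t) (c' s) \<le> D2 + D1"
    if c: "bilip K {..N} c" and c': "bilip K {..N'} c'" and e: "c 0 = c' 0" "c N = c' N'"
      and t: "t \<le> N" for N c N' c' t
  proof -
    obtain p where p: "geodesic_segment G S (c 0) (c N) p"
      using geodesic_exists bilipD(1)[OF c] by (metis atMost_iff le0 order_refl)
    obtain i where i: "i \<le> d (c 0) (c N)" "d (c t) (p i) \<le> D2"
      using D2[OF c p t] by blast
    obtain s where s: "s \<le> N'" "d (p i) (c' s) \<le> D1"
      using D1[OF c', of p i] p i e by auto
    show ?thesis
      using d_triangle[of "c t" "p i" "c' s"] bilipD(1)[OF c, of t] bilipD(1)[OF c', of s]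
        geodesicD(5)[OF p i(1)] i s t by (intro exI[of _ s]) auto
  qed
  then show ?thesis using that by blast
qed

end

section \<open>Geodesic rays\<close>

text \<open>Koenig's lemma: among infinitely many \<open>n\<close> that agree on the first
  \<open>k\<close> entries, the pigeonhole principle finds infinitely many that also agree on entry
  \<open>k\<close>.\<close>

lemma diagonal_limit:
  fixes p :: "nat \<Rightarrow> nat \<Rightarrow> 'a"
  assumes "\<And>i. finite (range (\<lambda>n. p n i))"
  obtains \<eta> where "\<And>k. infinite {n. \<forall>i<k. p n i = \<eta> i}"
proof -
  have "\<exists>e. \<forall>k. infinite {n. \<forall>i<k. p n i = e k i} \<and> (\<forall>i<k. e (Suc k) i = e k i)"
  proof (rule dependent_nat_choice)
    show "\<exists>e. infinite {n. \<forall>i<0. p n i = e i}" by simp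
    fix e k assume inf: "infinite {n. \<forall>i<k. p n i = (e :: nat \<Rightarrow> 'a) i}"
    let ?A = "{n. \<forall>i<k. p n i = e i}"
    have "\<exists>y \<in> (\<lambda>n. p n k) ` ?A. infinite {a \<in> ?A. p a k = y}"
    proof (rule pigeonhole_infinite_rel[OF inf])
      show "finite ((\<lambda>n. p n k) ` ?A)" by (rule finite_subset[OF _ assms[of k]]) auto
    qed auto
    then obtain y where y: "infinite {a \<in> ?A. p a k = y}" by blast
    have eq: "{n. \<forall>i<Suc k. p n i = (e(k := y)) i} = {a \<in> ?A. p a k = y}"
      by (auto simp: less_Suc_eq)
    show "\<exists>e'. infinite {n. \<forall>i<Suc k. p n i = e' i} \<and> (\<forall>i<k. e' i = e i)"
      by (rule exI[of _ "e(k := y)"], unfold eq) (use y in auto)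
  qed
  then obtain e where e: "\<And>k. infinite {n. \<forall>i<k. p n i = e k i}"
    and step: "\<And>k i. i < k \<Longrightarrow> e (Suc k) i = e k i" by blast
  have stable: "e k i = e (Suc i) i" if "Suc i \<le> k" for i k
    using that by (induction k rule: dec_induct) (auto simp: step)
  show ?thesis
  \<comment> \<open>Entry \<open>i\<close> is settled from stage \<open>Suc i\<close> on.\<close>
  proof (rule that[of "\<lambda>i. e (Suc i) i"])
    fix k
    have "{n. \<forall>i<k. p n i = e (Suc i) i} = {n. \<forall>i<k. p n i = e k i}"
      using stable by (metis Suc_leI)
    then show "infinite {n. \<forall>i<k. p n i = e (Suc i) i}" using e by simp
  qed
qed

section \<open>Change of generators and limits of geodesic segments\<close>

context word_metric
begin

lemma word_metric_comparison:
  assumes "word_metric G S'"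
  obtains M where "M > 0" "\<And>x y. x \<in> carrier G \<Longrightarrow> y \<in> carrier G \<Longrightarrow> word_dist G S' x y \<le> M * d x y"
proof -
  interpret S': word_metric G S' by fact
  obtain M where M: "\<And>g. g \<in> carrier G \<Longrightarrow> S'.len g \<le> M * len g"
    using subadditive_le_len[of S'.len] S'.len_mult_le by auto
  \<comment> \<open>\<open>Suc M\<close> makes the constant positive, which
    \<open>bilip_change_generators\<close> relies on.\<close>
  have "S'.d x y \<le> Suc M * d x y" if "x \<in> carrier G" "y \<in> carrier G" for x y
    unfolding word_dist_def using M[of "inv x \<otimes> y"] that by (simp add: trans_le_add2)
  then show ?thesis using that by blast
qed

text \<open>One constant has to serve both inequalities, hence the product of the two comparison
  constants; as they are positive, the other factor may always be inserted.\<close>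

lemma bilip_change_generators:
  assumes S': "word_metric G S'"
  obtains M where "\<And>K I c. bilip K I c \<Longrightarrow> word_metric.bilip G S' (M * K) I c"
proof -
  interpret S': word_metric G S' by fact
  obtain M1 where M1: "M1 > 0" "\<And>x y. x \<in> carrier G \<Longrightarrow> y \<in> carrier G \<Longrightarrow> S'.d x y \<le> M1 * d x y"
    using word_metric_comparison[OF S'] by blast
  obtain M2 where M2: "M2 > 0" "\<And>x y. x \<in> carrier G \<Longrightarrow> y \<in> carrier G \<Longrightarrow> d x y \<le> M2 * S'.d x y"
    using S'.word_metric_comparison[OF word_metric_axioms] by blast
  have "S'.bilip ((M1 * M2) * K) I c" if c: "bilip K I c" for K I c
    unfolding S'.bilip_def
  proof (intro conjI ballI impI)
    fix i j assume ij: "i \<in> I" "j \<in> I" "i \<le> j"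
    note cc = bilipD[OF c]
    have cij: "c i \<in> carrier G" "c j \<in> carrier G" using cc(1) ij by auto
    have "S'.d (c i) (c j) \<le> M1 * (K * (j - i))"
      using M1(2)[OF cij] cc(2)[OF ij] by (meson le_trans mult_le_mono2)
    also have "\<dots> \<le> M2 * (M1 * (K * (j - i)))" using M2(1) by simp
    finally show "S'.d (c i) (c j) \<le> M1 * M2 * K * (j - i)" by (simp add: ac_simps)
    have "j - i \<le> K * (M2 * S'.d (c i) (c j))"
      using M2(2)[OF cij] cc(3)[OF ij] by (meson le_trans mult_le_mono2)
    also have "\<dots> \<le> M1 * (K * (M2 * S'.d (c i) (c j)))" using M1(1) by simp
    finally show "j - i \<le> M1 * M2 * K * S'.d (c i) (c j)" by (simp add: ac_simps)
  qed (use bilipD(1)[OF c] in blast)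
  then show ?thesis using that by blast
qed

text \<open>Used to round a real slimness constant up to a natural number, as
  \<open>hyperbolic_metric\<close> expects.\<close>

lemma cayley_hyperbolic_mono:
  assumes hyp: "cayley_hyperbolic G S' \<delta>" and le: "\<delta> \<le> \<delta>'"
  shows "cayley_hyperbolic G S' \<delta>'"
  unfolding cayley_hyperbolic_def
proof (intro ballI allI impI)
  fix x y z p q r i
  assume "x \<in> carrier G" "y \<in> carrier G" "z \<in> carrier G" "geodesic_segment G S' x y p"
    "geodesic_segment G S' y z q" "geodesic_segment G S' z x r" "i \<le> word_dist G S' x y"
  from hyp[unfolded cayley_hyperbolic_def, rule_format, OF this]
  show "(\<exists>j\<le>word_dist G S' y z. real (word_dist G S' (p i) (q j)) \<le> \<delta>') \<or>
        (\<exists>k\<le>word_dist G S' z x. real (word_dist G S' (p i) (r k)) \<le> \<delta>')"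
    using le by (meson order_trans)
qed

lemma bilip_fellow_travel_change_generators:
  assumes "hyperbolic_group G"
  obtains D where "\<And>N c N' c' t. bilip K {..N} c \<Longrightarrow> bilip K {..N'} c' \<Longrightarrow> c 0 = c' 0 \<Longrightarrow>
    c N = c' N' \<Longrightarrow> t \<le> N \<Longrightarrow> \<exists>s\<le>N'. d (c t) (c' s) \<le> D"
proof -
  obtain S' \<delta> where S': "finite_generating_set G S'" and hyp: "cayley_hyperbolic G S' \<delta>"
    using assms unfolding hyperbolic_group_def by blast
  have "cayley_hyperbolic G S' (real (nat \<lceil>\<delta>\<rceil>))"
    by (rule cayley_hyperbolic_mono[OF hyp real_nat_ceiling_ge])
  then interpret S': hyperbolic_metric G S' "nat \<lceil>\<delta>\<rceil>"
    using S' by unfold_locales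
  obtain M where M: "\<And>K I c. bilip K I c \<Longrightarrow> S'.bilip (M * K) I c"
    using bilip_change_generators[OF S'.word_metric_axioms] by blast
  obtain M2 where M2: "\<And>x y. x \<in> carrier G \<Longrightarrow> y \<in> carrier G \<Longrightarrow> d x y \<le> M2 * S'.d x y"
    using S'.word_metric_comparison[OF word_metric_axioms] by blast
  obtain D where D: "\<And>N c N' c' t. S'.bilip (M * K) {..N} c \<Longrightarrow> S'.bilip (M * K) {..N'} c' \<Longrightarrow>
    c 0 = c' 0 \<Longrightarrow> c N = c' N' \<Longrightarrow> t \<le> N \<Longrightarrow> \<exists>s\<le>N'. S'.d (c t) (c' s) \<le> D"
    using S'.bilip_fellow_travel by blast
  have "\<exists>s\<le>N'. d (c t) (c' s) \<le> M2 * D"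
    if c: "bilip K {..N} c" and c': "bilip K {..N'} c'" and e: "c 0 = c' 0" "c N = c' N'" and t: "t \<le> N"
    for N c N' c' t
  proof -
    obtain s where s: "s \<le> N'" "S'.d (c t) (c' s) \<le> D"
      using D[OF M[OF c] M[OF c'] e t] by blast
    have "d (c t) (c' s) \<le> M2 * S'.d (c t) (c' s)"
      using M2 bilipD(1)[OF c] bilipD(1)[OF c'] t s(1) by simp
    also have "\<dots> \<le> M2 * D" using s(2) by simp
    finally show ?thesis using s(1) by blast
  qed
  then show ?thesis using that by blast
qed

text \<open>Geodesic segments from \<open>\<one>\<close> to \<open>q n\<close> fellow travel with
  \<open>q\<close> at a distance independent of \<open>n\<close>, and a pointwise limit of them
  inherits this.\<close>

theorem bilip_ray_near_geodesic_ray: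
  assumes hyp: "hyperbolic_group G" and q: "bilip K UNIV q" and q0: "q 0 = \<one>"
  obtains \<eta> where "\<eta> \<in> geodesic_rays G S" "finite_hausdorff_dist G S (range q) (range \<eta>)"
proof -
  have "\<exists>p. geodesic_segment G S \<one> (q n) p" for n
    using geodesic_exists[OF one_closed bilipD(1)[OF q]] by blast
  then obtain p where p: "\<And>n. geodesic_segment G S \<one> (q n) (p n)" by metis
  define m where "m n = d \<one> (q n)" for n
  \<comment> \<open>Segments are bilipschitz with constant 1, so a common constant is at least
    1.\<close>
  define K' where "K' = max K 1"
  have bq: "bilip K' {..n} q" for n using bilip_mono[OF q] unfolding K'_def by simp
  have bp: "bilip K' {..m n} (p n)" for n
    unfolding m_def using bilip_mono[OF bilip_geodesic[OF p]] unfolding K'_def by simp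
  obtain D where D: "\<And>N c N' c' t. bilip K' {..N} c \<Longrightarrow> bilip K' {..N'} c' \<Longrightarrow> c 0 = c' 0 \<Longrightarrow>
    c N = c' N' \<Longrightarrow> t \<le> N \<Longrightarrow> \<exists>s\<le>N'. d (c t) (c' s) \<le> D"
    using bilip_fellow_travel_change_generators[OF hyp] by blast
  note P = geodesicD[OF p, folded m_def]
  have near_q: "\<exists>s\<le>n. d (p n t) (q s) \<le> D" if "t \<le> m n" for n t
    using D[OF bp bq, of n n t] that P q0 by simp
  have near_p: "\<exists>s\<le>m n. d (q t) (p n s) \<le> D" if "t \<le> n" for n t
    using D[OF bq bp, of n n t] that P q0 by simp
  \<comment> \<open>\<open>q\<close> escapes at linear speed, so the segments become arbitrarily
    long.\<close>
  have m_large: "i \<le> m n" if "K * i \<le> n" "i > 0" for i n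
  proof (cases "K = 0")
    case True
    then show ?thesis using bilipD(3)[OF q, of 0 1] by simp
  next
    case False
    have "K * i \<le> K * m n"
      using bilipD(3)[OF q, of 0 n] that(1) unfolding m_def q0 by (metis UNIV_I diff_zero le0 le_trans)
    then show ?thesis using False by simp
  qed
  \<comment> \<open>Past its end a segment is padded with \<open>\<one>\<close>, which keeps entry
    \<open>i\<close> in the finite ball of radius \<open>i\<close>.\<close>
  have fin: "finite (range (\<lambda>n. if i \<le> m n then p n i else \<one>))" for i
  proof (rule finite_subset[OF _ finite_d_ball[OF one_closed, of i]])
    show "range (\<lambda>n. if i \<le> m n then p n i else \<one>) \<subseteq> {y \<in> carrier G. d \<one> y \<le> i}"
      using P(6)[of 0 i] P(1,5) by auto
  qed
  obtain \<eta> where "\<And>k. infinite {n. \<forall>i<k. (if i \<le> m n then p n i else \<one>) = \<eta> i}"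
    using diagonal_limit[of "\<lambda>n i. if i \<le> m n then p n i else \<one>", OF fin] by blast
  then have \<eta>: "\<exists>n\<ge>k. \<forall>i<k. (if i \<le> m n then p n i else \<one>) = \<eta> i" for k
  proof -
    assume inf: "\<And>k. infinite {n. \<forall>i<k. (if i \<le> m n then p n i else \<one>) = \<eta> i}"
    show ?thesis using inf[of k] unfolding infinite_nat_iff_unbounded_le by blast
  qed
  have agree: "\<exists>n\<ge>k. \<forall>i<k. i \<le> m n \<and> p n i = \<eta> i" for k
  proof -
    \<comment> \<open>\<open>n \<ge> K * k\<close> makes the segment reach index \<open>k\<close>,
      so none of the first \<open>k\<close> entries is padding.\<close>
    obtain n where n: "n \<ge> k + K * k" "\<And>i. i < k + K * k \<Longrightarrow> (if i \<le> m n then p n i else \<one>) = \<eta> i"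
      using \<eta>[of "k + K * k"] by blast
    have le: "i \<le> m n" if "i < k" for i
      using m_large[of k n] n(1) that by simp
    moreover have "p n i = \<eta> i" if "i < k" for i
      using n(2)[of i] le[OF that] that by simp
    ultimately show ?thesis using n(1) le by (intro exI[of _ n]) auto
  qed
  have ray: "\<eta> \<in> geodesic_rays G S"
    unfolding geodesic_rays_def
  proof (intro CollectI conjI allI impI)
    show "\<eta> 0 = \<one>" using agree[of 1] P(1) by auto
    show "\<eta> i \<in> carrier G" for i using agree[of "Suc i"] P(5) by (metis lessI)
    fix i j :: nat assume ij: "i \<le> j"
    obtain n where n: "\<And>i. i < Suc j \<Longrightarrow> i \<le> m n \<and> p n i = \<eta> i" using agree[of "Suc j"] by blast
    show "d (\<eta> i) (\<eta> j) = j - i" using P(6)[OF ij, of n] n[of i] n[of j] ij by simp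
  qed
  have \<eta>c: "\<eta> i \<in> carrier G" and \<eta>d: "d \<one> (\<eta> i) = i" for i
    using ray unfolding geodesic_rays_def by (auto, metis le0 diff_zero)
  have qc: "q i \<in> carrier G" for i using bilipD(1)[OF q] by simp
  have "\<exists>b\<in>range \<eta>. d a b \<le> D" if "a \<in> range q" for a
  proof -
    from that obtain t where t: "a = q t" by blast
    \<comment> \<open>The segment point near \<open>q t\<close> has index at most
      \<open>len (q t) + D\<close>, so agreement up to \<open>k\<close> places it on
      \<open>\<eta>\<close>.\<close>
    define k where "k = Suc (t + len (q t) + D)"
    obtain n where n: "n \<ge> k" "\<And>i. i < k \<Longrightarrow> i \<le> m n \<and> p n i = \<eta> i" using agree[of k] by blast
    obtain s where s: "s \<le> m n" "d (q t) (p n s) \<le> D" using near_p[of t n] n(1) unfolding k_def by auto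
    have "s = d \<one> (p n s)" using P(6)[of 0 s n] P(1) s(1) by simp
    also have "\<dots> \<le> len (q t) + D"
      using d_triangle[OF one_closed qc[of t] P(5)[OF s(1)]] s(2) d_one_left[OF qc] by simp
    finally have "s < k" unfolding k_def by simp
    then show ?thesis using s(2) n(2) t by (metis rangeI)
  qed
  moreover have "\<exists>a\<in>range q. d a b \<le> D" if "b \<in> range \<eta>" for b
  proof -
    from that obtain i where i: "b = \<eta> i" by blast
    obtain n where n: "i \<le> m n" "p n i = \<eta> i" using agree[of "Suc i"] by blast
    then show ?thesis using near_q[of i n] d_commute[OF \<eta>c qc] i by (metis rangeI)
  qed
  ultimately have "finite_hausdorff_dist G S (range q) (range \<eta>)"
    unfolding finite_hausdorff_dist_def by blast
  with ray show ?thesis by (rule that)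
qed

end

section \<open>Torsion-free nilpotent groups\<close>

context group
begin

lemma inv_mult_cancel_left: "x \<in> carrier G \<Longrightarrow> y \<in> carrier G \<Longrightarrow> inv x \<otimes> (x \<otimes> y) = y"
  and mult_inv_cancel_left: "x \<in> carrier G \<Longrightarrow> y \<in> carrier G \<Longrightarrow> x \<otimes> (inv x \<otimes> y) = y"
  by (simp_all flip: m_assoc)

lemmas group_word_simps = m_assoc inv_mult_group inv_mult_cancel_left mult_inv_cancel_left

lemma commutator_eq_one_iff:
  assumes "x \<in> carrier G" "y \<in> carrier G"
  shows "x \<otimes> y \<otimes> inv x \<otimes> inv y = \<one> \<longleftrightarrow> x \<otimes> y = y \<otimes> x"
proof
  assume "x \<otimes> y \<otimes> inv x \<otimes> inv y = \<one>"
  then have "(x \<otimes> y \<otimes> inv x \<otimes> inv y) \<otimes> (y \<otimes> x) = \<one> \<otimes> (y \<otimes> x)" by simp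
  then show "x \<otimes> y = y \<otimes> x" using assms by (simp add: group_word_simps)
next
  assume "x \<otimes> y = y \<otimes> x"
  then show "x \<otimes> y \<otimes> inv x \<otimes> inv y = \<one>" using assms by (simp add: group_word_simps)
qed

lemma conj_nat_pow:
  assumes "x \<in> carrier G" "y \<in> carrier G"
  shows "(y \<otimes> x \<otimes> inv y) [^] (n::nat) = y \<otimes> x [^] n \<otimes> inv y"
  using assms by (induction n) (simp_all add: group_word_simps)

lemma rcos_eq_iff:
  assumes "N \<lhd> G" "x \<in> carrier G" "y \<in> carrier G"
  shows "N #> x = N #> y \<longleftrightarrow> x \<otimes> inv y \<in> N"
proof -
  interpret N: normal N G by fact
  have "N #> x = N #> y \<longleftrightarrow> x \<in> N #> y"
    using assms N.is_subgroup rcos_self repr_independence by metis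
  then show ?thesis using assms N.rcos_module[OF is_group] by simp
qed

text \<open>Written with cosets, membership is commutation in the factor group;
  \<open>mem_upper_central_Suc\<close> gives the commutator form.\<close>

primrec upper_central :: "nat \<Rightarrow> 'a set" where
  "upper_central 0 = {\<one>}"
| "upper_central (Suc n) =
    {x \<in> carrier G. \<forall>y \<in> carrier G. upper_central n #> (x \<otimes> y) = upper_central n #> (y \<otimes> x)}"

lemma commute_inv:
  assumes "x \<in> carrier G" "y \<in> carrier G" "x \<otimes> y = y \<otimes> x"
  shows "inv x \<otimes> y = y \<otimes> inv x"
proof -
  have "inv x \<otimes> (x \<otimes> y) \<otimes> inv x = inv x \<otimes> (y \<otimes> x) \<otimes> inv x" using assms(3) by simp
  then show ?thesis using assms(1,2) by (simp add: group_word_simps)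
qed

text \<open>The set is the preimage of the centre of \<open>G Mod N\<close>, and the computations
  are moved there along \<open>\<pi>\<close>.\<close>

lemma normal_commuting_mod:
  assumes N: "N \<lhd> G"
  shows "{x \<in> carrier G. \<forall>y \<in> carrier G. N #> (x \<otimes> y) = N #> (y \<otimes> x)} \<lhd> G"
    (is "?Z \<lhd> G")
proof -
  interpret N: normal N G by fact
  interpret Q: group "G Mod N" by (rule N.factorgroup_is_group)
  define \<pi> where "\<pi> x = N #> x" for x
  have hom: "\<pi> (x \<otimes> y) = \<pi> x \<otimes>\<^bsub>G Mod N\<^esub> \<pi> y" if "x \<in> carrier G" "y \<in> carrier G" for x y
    unfolding \<pi>_def using that N.r_coset_hom_Mod by (auto simp: hom_def)
  have cl: "\<pi> x \<in> carrier (G Mod N)" if "x \<in> carrier G" for x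
    unfolding \<pi>_def using that N.r_coset_hom_Mod by (auto simp: hom_def)
  have inv: "\<pi> (inv x) = inv\<^bsub>G Mod N\<^esub> \<pi> x" if "x \<in> carrier G" for x
    using that hom[of "inv x" x] cl[of x] cl[of "inv x"] coset_join2[OF one_closed N.is_subgroup]
    by (intro Q.inv_equality[symmetric]) (auto simp: \<pi>_def)
  have Z: "x \<in> ?Z \<longleftrightarrow> x \<in> carrier G \<and>
      (\<forall>y \<in> carrier G. \<pi> x \<otimes>\<^bsub>G Mod N\<^esub> \<pi> y = \<pi> y \<otimes>\<^bsub>G Mod N\<^esub> \<pi> x)" for x
    using hom unfolding \<pi>_def by auto
  show ?thesis
    unfolding normal_inv_iff
  proof (intro conjI ballI)
    show "subgroup ?Z G"
    proof (rule subgroupI)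
      show "?Z \<noteq> {}" by auto
      fix a b assume a: "a \<in> ?Z" and b: "b \<in> ?Z"
      then have ab: "a \<in> carrier G" "b \<in> carrier G" by auto
      show "a \<otimes> b \<in> ?Z"
        unfolding Z
      proof (intro conjI ballI)
        fix y assume "y \<in> carrier G"
        then show "\<pi> (a \<otimes> b) \<otimes>\<^bsub>G Mod N\<^esub> \<pi> y = \<pi> y \<otimes>\<^bsub>G Mod N\<^esub> \<pi> (a \<otimes> b)"
          using a[unfolded Z] b[unfolded Z] hom[OF ab] cl ab by (metis Q.m_assoc)
      qed (use ab in simp)
      show "inv a \<in> ?Z"
        unfolding Z
      proof (intro conjI ballI)
        fix y assume "y \<in> carrier G"
        then show "\<pi> (inv a) \<otimes>\<^bsub>G Mod N\<^esub> \<pi> y = \<pi> y \<otimes>\<^bsub>G Mod N\<^esub> \<pi> (inv a)"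
          using a[unfolded Z] inv[OF ab(1)] cl ab by (metis Q.commute_inv)
      qed (use ab in simp)
    qed auto
    fix x h assume x: "x \<in> carrier G" and h: "h \<in> ?Z"
    then have hc: "h \<in> carrier G" by auto
    have "\<pi> (x \<otimes> h \<otimes> inv x) = \<pi> h \<otimes>\<^bsub>G Mod N\<^esub> (\<pi> x \<otimes>\<^bsub>G Mod N\<^esub> \<pi> (inv x))"
      using h[unfolded Z] x hc hom cl Q.m_assoc by (metis inv_closed m_closed)
    also have "\<dots> = \<pi> h"
      unfolding inv[OF x] Q.r_inv[OF cl[OF x]] by (rule Q.r_one[OF cl[OF hc]])
    finally show "x \<otimes> h \<otimes> inv x \<in> ?Z"
      using h[unfolded Z] x hc unfolding Z by simp
  qed
qed

lemma normal_upper_central: "upper_central n \<lhd> G"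
proof (induction n)
  case 0
  show ?case using triv_subgroup by (auto simp: normal_inv_iff)
next
  case (Suc n)
  then show ?case using normal_commuting_mod by simp
qed

lemma upper_central_carrier: "upper_central n \<subseteq> carrier G"
  by (induction n) auto

lemma mem_upper_central_Suc:
  assumes "x \<in> carrier G"
  shows "x \<in> upper_central (Suc n) \<longleftrightarrow>
    (\<forall>y \<in> carrier G. x \<otimes> y \<otimes> inv x \<otimes> inv y \<in> upper_central n)"
proof -
  have "x \<otimes> y \<otimes> inv (y \<otimes> x) = x \<otimes> y \<otimes> inv x \<otimes> inv y" if "y \<in> carrier G" for y
    using assms that by (simp add: inv_mult_group m_assoc)
  then show ?thesis
    using assms rcos_eq_iff[OF normal_upper_central, of "x \<otimes> _" "_ \<otimes> x"] by simp
qed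

lemma lower_central_carrier: "lower_central G n \<subseteq> carrier G"
proof (induction n)
  case (Suc n)
  then have "(\<Union>x \<in> lower_central G n. \<Union>y \<in> carrier G. {x \<otimes> y \<otimes> inv x \<otimes> inv y}) \<subseteq> carrier G"
    by (fastforce intro: m_closed)
  then show ?case unfolding lower_central.simps by (rule generate_incl)
qed simp

lemma commutator_mem_lower_central:
  "x \<in> lower_central G n \<Longrightarrow> y \<in> carrier G \<Longrightarrow> x \<otimes> y \<otimes> inv x \<otimes> inv y \<in> lower_central G (Suc n)"
  unfolding lower_central.simps by (rule generate.incl) blast

text \<open>Commutators with elements of term \<open>c - Suc i\<close> lie in term
  \<open>c - i\<close>, hence in \<open>upper_central i\<close> by induction. This leads from the
  series that defines nilpotency to the one whose factors inherit torsion-freeness.\<close>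

lemma lower_central_le_upper_central:
  assumes "lower_central G c = {\<one>}" "i \<le> c"
  shows "lower_central G (c - i) \<subseteq> upper_central i"
  using assms(2)
proof (induction i)
  case 0
  then show ?case using assms(1) by simp
next
  case (Suc i)
  have e: "Suc (c - Suc i) = c - i" using Suc.prems by simp
  show ?case
  proof
    fix x assume x: "x \<in> lower_central G (c - Suc i)"
    then have xc: "x \<in> carrier G" using lower_central_carrier by blast
    show "x \<in> upper_central (Suc i)"
      unfolding mem_upper_central_Suc[OF xc]
    proof
      fix y assume "y \<in> carrier G"
      from commutator_mem_lower_central[OF x this] Suc
      show "x \<otimes> y \<otimes> inv x \<otimes> inv y \<in> upper_central i" unfolding e by (meson Suc_leD subsetD)
    qed
  qed
qed

lemma nilpotent_upper_central:
  assumes "nilpotent_group G"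
  obtains c where "upper_central c = carrier G"
proof -
  obtain c where "lower_central G c = {\<one>}" using assms unfolding nilpotent_group_def by blast
  from lower_central_le_upper_central[OF this order_refl] have "carrier G \<subseteq> upper_central c" by simp
  then show ?thesis using that upper_central_carrier by blast
qed

text \<open>Every commutator of \<open>x\<close> satisfies the same hypotheses one term lower. By
  induction it drops by one term, and therefore so does \<open>x\<close>.\<close>

lemma upper_central_step_torsion_free:
  assumes tf: "torsion_free_group G" and n: "n > (0::nat)"
    and "x \<in> upper_central (Suc i)" "x [^] n \<in> upper_central i"
  shows "x \<in> upper_central i"
  using assms(3,4)
proof (induction i arbitrary: x)
  case 0
  then show ?case using tf n unfolding torsion_free_group_def by auto
next
  case (Suc i)
  have xc: "x \<in> carrier G" using Suc.prems(1) by simp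
  let ?N = "upper_central i"
  interpret N: normal ?N G by (rule normal_upper_central)
  interpret Q: group "G Mod ?N" by (rule N.factorgroup_is_group)
  interpret h: group_hom G "G Mod ?N" "\<lambda>x. ?N #> x"
    using N.r_coset_hom_Mod by unfold_locales
  show ?case
    unfolding mem_upper_central_Suc[OF xc]
  proof
    fix y assume y: "y \<in> carrier G"
    define c where "c = x \<otimes> y \<otimes> inv x \<otimes> inv y"
    have cc: "c \<in> carrier G" unfolding c_def using xc y by simp
    have "c \<in> upper_central (Suc i)"
      using Suc.prems(1) y unfolding mem_upper_central_Suc[OF xc] c_def by blast
    then have comm: "(?N #> c) \<otimes>\<^bsub>G Mod ?N\<^esub> (?N #> z) = (?N #> z) \<otimes>\<^bsub>G Mod ?N\<^esub> (?N #> c)"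
      if "z \<in> carrier G" for z
    proof -
      have "?N #> (c \<otimes> z) = ?N #> (z \<otimes> c)"
        using that \<open>c \<in> upper_central (Suc i)\<close> by (simp del: h.hom_mult)
      then show ?thesis unfolding h.hom_mult[OF cc that] h.hom_mult[OF that cc] .
    qed
    \<comment> \<open>Modulo \<open>upper_central i\<close> the central \<open>c\<close> gives
      \<open>(y x y\<^sup>-\<^sup>1)\<^sup>n = c\<^sup>-\<^sup>n x\<^sup>n\<close>. As \<open>x\<^sup>n\<close> is central, \<open>c\<^sup>n\<close> is trivial.\<close>
    define w where "w = y \<otimes> x \<otimes> inv y"
    have w: "w \<in> carrier G" "x = c \<otimes> w"
      unfolding w_def c_def using xc y by (simp_all add: group_word_simps)
    have xn: "x [^] n \<in> carrier G" using xc by simp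
    have "w [^] n \<otimes> inv (x [^] n) = y \<otimes> x [^] n \<otimes> inv (x [^] n \<otimes> y)"
      unfolding w_def conj_nat_pow[OF xc y] using xn y by (simp add: m_assoc inv_mult_group)
    moreover have "?N #> (y \<otimes> x [^] n) = ?N #> (x [^] n \<otimes> y)"
      using Suc.prems(2) y by (simp del: h.hom_mult)
    ultimately have "?N #> (w [^] n) = ?N #> (x [^] n)"
      using rcos_eq_iff[OF N.normal_axioms] xn y w(1) by (metis m_closed nat_pow_closed)
    moreover have "?N #> (x [^] n) = (?N #> (c [^] n)) \<otimes>\<^bsub>G Mod ?N\<^esub> (?N #> (w [^] n))"
    proof -
      have "(?N #> x) [^]\<^bsub>G Mod ?N\<^esub> n = (?N #> c) [^]\<^bsub>G Mod ?N\<^esub> n \<otimes>\<^bsub>G Mod ?N\<^esub> (?N #> w) [^]\<^bsub>G Mod ?N\<^esub> n"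
        unfolding w(2) h.hom_mult[OF cc w(1)] by (rule Q.pow_mult_distrib[OF comm[OF w(1)]]) (use w(1) cc in auto)
      then show ?thesis using xc cc w(1) by (simp flip: h.hom_nat_pow)
    qed
    ultimately have "?N #> (c [^] n) = \<one>\<^bsub>G Mod ?N\<^esub>"
      using cc w by (metis Q.r_cancel_one' h.hom_closed nat_pow_closed)
    then have "c [^] n \<in> ?N"
      using cc coset_join1[OF _ _ N.is_subgroup] unfolding FactGroup_def by simp
    with \<open>c \<in> upper_central (Suc i)\<close> have "c \<in> ?N" by (rule Suc.IH)
    then show "x \<otimes> y \<otimes> inv x \<otimes> inv y \<in> upper_central i" unfolding c_def .
  qed
qed

text \<open>The quotient \<open>z\<close> of the two roots descends the upper central series. Modulo
  the next lower term it is central, so there \<open>x [^] n\<close> is the product of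
  \<open>z [^] n\<close> and \<open>y [^] n\<close>, and \<open>z [^] n\<close> vanishes;
  torsion-freeness of the factor puts \<open>z\<close> into that term.\<close>

lemma nilpotent_torsion_free_unique_roots:
  assumes nil: "nilpotent_group G" and tf: "torsion_free_group G" and n: "n > (0::nat)"
    and x: "x \<in> carrier G" and y: "y \<in> carrier G" and eq: "x [^] n = y [^] n"
  shows "x = y"
proof -
  obtain c where c: "upper_central c = carrier G" using nilpotent_upper_central[OF nil] .
  define z where "z = x \<otimes> inv y"
  have z: "z \<in> carrier G" "x = z \<otimes> y"
    unfolding z_def using x y by (simp_all add: m_assoc)
  have "z \<in> upper_central (c - i)" if "i \<le> c" for i
    using that
  proof (induction i)
    case 0
    then show ?case using z c by simp
  next
    case (Suc i)
    define k where "k = c - Suc i"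
    have zk: "z \<in> upper_central (Suc k)"
      using Suc unfolding k_def by (simp add: Suc_diff_Suc del: upper_central.simps)
    let ?N = "upper_central k"
    interpret N: normal ?N G by (rule normal_upper_central)
    interpret Q: group "G Mod ?N" by (rule N.factorgroup_is_group)
    interpret h: group_hom G "G Mod ?N" "\<lambda>x. ?N #> x"
      using N.r_coset_hom_Mod by unfold_locales
    have comm: "(?N #> z) \<otimes>\<^bsub>G Mod ?N\<^esub> (?N #> y) = (?N #> y) \<otimes>\<^bsub>G Mod ?N\<^esub> (?N #> z)"
    proof -
      have "?N #> (z \<otimes> y) = ?N #> (y \<otimes> z)" using zk y by (simp del: h.hom_mult)
      then show ?thesis unfolding h.hom_mult[OF z(1) y] h.hom_mult[OF y z(1)] .
    qed
    have "?N #> (x [^] n) = (?N #> (z [^] n)) \<otimes>\<^bsub>G Mod ?N\<^esub> (?N #> (x [^] n))"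
    proof -
      have "(?N #> x) [^]\<^bsub>G Mod ?N\<^esub> n = (?N #> z) [^]\<^bsub>G Mod ?N\<^esub> n \<otimes>\<^bsub>G Mod ?N\<^esub> (?N #> y) [^]\<^bsub>G Mod ?N\<^esub> n"
        unfolding z(2) h.hom_mult[OF z(1) y] by (rule Q.pow_mult_distrib[OF comm]) (use z(1) y in auto)
      then show ?thesis using eq x y z(1) by (simp flip: h.hom_nat_pow)
    qed
    then have "?N #> (z [^] n) = \<one>\<^bsub>G Mod ?N\<^esub>"
      using z x by (metis Q.r_cancel_one' h.hom_closed nat_pow_closed)
    then have "z [^] n \<in> ?N"
      using z coset_join1[OF _ _ N.is_subgroup] unfolding FactGroup_def by simp
    then show ?case
      using upper_central_step_torsion_free[OF tf n zk] unfolding k_def by blast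
  qed
  from this[of c] have "z = \<one>" by simp
  then show ?thesis using z y by simp
qed

lemma nilpotent_nontrivial_hom:
  assumes nil: "nilpotent_group G" and g: "g \<in> carrier G" "g \<noteq> \<one>"
  obtains h where "h \<in> hom G G" "\<And>x y. x \<in> carrier G \<Longrightarrow> y \<in> carrier G \<Longrightarrow> h x \<otimes> h y = h y \<otimes> h x"
    "\<exists>x \<in> carrier G. h x \<noteq> \<one>"
proof -
  obtain c where c: "lower_central G c = {\<one>}" "\<And>i. i < c \<Longrightarrow> lower_central G i \<noteq> {\<one>}"
  proof -
    from nil have ex: "\<exists>n. lower_central G n = {\<one>}" unfolding nilpotent_group_def by blast
    then show ?thesis
      using that[of "LEAST n. lower_central G n = {\<one>}"] LeastI_ex[OF ex] not_less_Least by blast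
  qed
  have "c \<noteq> 0"
  proof
    assume "c = 0"
    with c(1) have "carrier G = {\<one>}" by simp
    then show False using g by blast
  qed
  then obtain b where b: "c = Suc b" using not0_implies_Suc by blast
  have central: "x \<otimes> y = y \<otimes> x" if "x \<in> lower_central G b" "y \<in> carrier G" for x y
  proof -
    have xc: "x \<in> carrier G" using that lower_central_carrier by blast
    have "x \<otimes> y \<otimes> inv x \<otimes> inv y = \<one>"
      using commutator_mem_lower_central[OF that] c(1) b by simp
    then show ?thesis using xc that(2) commutator_eq_one_iff by simp
  qed
  have nt: "lower_central G b \<noteq> {\<one>}" using c b by simp
  show ?thesis
  proof (cases b)
    case 0
    then show ?thesis
      using that[of id] central g by (auto simp: hom_def)
  next
    case (Suc a)
    \<comment> \<open>Otherwise all generators of term \<open>b\<close> would be trivial.\<close>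
    have "\<exists>x\<in>lower_central G a. \<exists>y\<in>carrier G. x \<otimes> y \<otimes> inv x \<otimes> inv y \<noteq> \<one>"
    proof (rule ccontr)
      assume "\<not> ?thesis"
      then have "(\<Union>x \<in> lower_central G a. \<Union>y \<in> carrier G. {x \<otimes> y \<otimes> inv x \<otimes> inv y}) \<subseteq> {\<one>}"
        by auto
      from mono_generate[OF this] have "lower_central G b \<subseteq> generate G {\<one>}" using Suc by simp
      then have "lower_central G b \<subseteq> {\<one>}" using generate_one by simp
      moreover have "\<one> \<in> lower_central G b" unfolding Suc by (simp add: generate.one)
      ultimately show False using nt by auto
    qed
    then obtain x y0 where x: "x \<in> lower_central G a" and y0: "y0 \<in> carrier G"
      "x \<otimes> y0 \<otimes> inv x \<otimes> inv y0 \<noteq> \<one>" by blast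
    have xc: "x \<in> carrier G" using x lower_central_carrier by blast
    define h where "h y = x \<otimes> y \<otimes> inv x \<otimes> inv y" for y
    have hb: "h y \<in> lower_central G b" if "y \<in> carrier G" for y
      unfolding h_def Suc by (rule commutator_mem_lower_central[OF x that])
    have hc: "h y \<in> carrier G" if "y \<in> carrier G" for y
      using hb[OF that] lower_central_carrier by blast
    have "h (y \<otimes> z) = h y \<otimes> h z" if y: "y \<in> carrier G" and z: "z \<in> carrier G" for y z
    proof -
      \<comment> \<open>This is \<open>[x, y z] = [x, y] (y [x, z] inv y)\<close>; centrality of
        \<open>[x, z]\<close> removes the conjugation.\<close>
      have "h (y \<otimes> z) = x \<otimes> y \<otimes> inv x \<otimes> (h z \<otimes> inv y)"
        unfolding h_def using xc y z by (simp add: group_word_simps)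
      also have "h z \<otimes> inv y = inv y \<otimes> h z" using central[OF hb[OF z]] y by simp
      finally show ?thesis unfolding h_def using xc y z by (simp add: m_assoc)
    qed
    then have "h \<in> hom G G" using hc by (intro homI) auto
    then show ?thesis
      using that[of h] central[OF hb] hc y0 unfolding h_def by blast
  qed
qed

end

section \<open>Homomorphisms to the integers\<close>

text \<open>The value \<open>r\<close> at \<open>s\<close> can be prescribed as soon as it agrees
  with \<open>f\<close> on those powers of \<open>s\<close> that already lie in
  \<open>B\<close>.\<close>

lemma (in comm_group) extend_additive:
  fixes f :: "'a \<Rightarrow> rat"
  assumes B: "subgroup B G" and s: "s \<in> carrier G"
    and f: "\<And>x y. x \<in> B \<Longrightarrow> y \<in> B \<Longrightarrow> f (x \<otimes> y) = f x + f y"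
    and r: "\<And>k::int. s [^] k \<in> B \<Longrightarrow> f (s [^] k) = of_int k * r"
  obtains B' f' where "subgroup B' G" "B \<subseteq> B'" "s \<in> B'"
    "\<And>x y. x \<in> B' \<Longrightarrow> y \<in> B' \<Longrightarrow> f' (x \<otimes> y) = f' x + f' y"
    "\<And>x. x \<in> B \<Longrightarrow> f' x = f x" "f' s = r"
proof -
  interpret B: subgroup B G by (rule B)
  have Bc: "b \<in> carrier G" if "b \<in> B" for b using that B.subset by blast
  define B' where "B' = {b \<otimes> s [^] k | b (k::int). b \<in> B}"
  \<comment> \<open>Some decomposition of \<open>x\<close> supplies the value; \<open>f'_eq\<close>
    shows that all decompositions give the same one.\<close>
  define f' where "f' x = (SOME v. \<exists>b (k::int). b \<in> B \<and> x = b \<otimes> s [^] k \<and> v = f b + of_int k * r)" for x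
  have f'_eq: "f' (b \<otimes> s [^] k) = f b + of_int k * r" if b: "b \<in> B" for b and k :: int
  proof -
    have "v = f b + of_int k * r"
      if b': "b' \<in> B" "b \<otimes> s [^] k = b' \<otimes> s [^] k'" "v = f b' + of_int k' * r" for v b' and k' :: int
    proof -
      have "s [^] (k - k') = inv b \<otimes> (b \<otimes> s [^] k) \<otimes> inv (s [^] k')"
        using Bc[OF b] s by (simp add: int_pow_diff inv_mult_cancel_left)
      also have "\<dots> = inv b \<otimes> b'"
        unfolding b'(2) using Bc[OF b] Bc[OF b'(1)] s by (simp add: m_assoc)
      finally have e: "s [^] (k - k') = inv b \<otimes> b'" .
      have mem: "s [^] (k - k') \<in> B" using b b' by (simp add: e)
      have "b' = b \<otimes> s [^] (k - k')"
        unfolding e using Bc[OF b] Bc[OF b'(1)] by (simp add: mult_inv_cancel_left)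
      then have "f b' = f b + of_int (k - k') * r" using f[OF b mem] r[OF mem] by simp
      then show ?thesis using b'(3) by (simp add: algebra_simps)
    qed
    then show ?thesis
      unfolding f'_def using b by (intro some_equality) blast+
  qed
  have mem: "b \<otimes> s [^] k \<in> B'" if "b \<in> B" for b and k :: int
    unfolding B'_def using that by blast
  have mult: "(b \<otimes> s [^] k) \<otimes> (b' \<otimes> s [^] k') = (b \<otimes> b') \<otimes> s [^] (k + k')"
    if "b \<in> B" "b' \<in> B" for b b' and k k' :: int
    using Bc[OF that(1)] Bc[OF that(2)] s by (simp add: int_pow_mult m_ac)
  show ?thesis
  proof
    show "subgroup B' G"
    proof (rule subgroupI)
      show "B' \<subseteq> carrier G" unfolding B'_def using Bc s by auto
      show "B' \<noteq> {}" using mem B.one_closed by blast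
      fix x assume "x \<in> B'"
      then obtain b and k :: int where x: "x = b \<otimes> s [^] k" "b \<in> B" unfolding B'_def by blast
      have "inv x = inv b \<otimes> s [^] (- k)"
        unfolding x(1) using Bc[OF x(2)] s by (simp add: inv_mult int_pow_neg)
      then show "inv x \<in> B'" using mem x(2) by simp
      fix y assume "y \<in> B'"
      then obtain b' and k' :: int where y: "y = b' \<otimes> s [^] k'" "b' \<in> B" unfolding B'_def by blast
      show "x \<otimes> y \<in> B'" unfolding x y mult[OF x(2) y(2)] using x(2) y(2) by (intro mem) simp
    qed
    show "B \<subseteq> B'"
    proof
      fix b assume "b \<in> B"
      then show "b \<in> B'" using mem[of b 0] Bc by simp
    qed
    show "s \<in> B'" using mem[OF B.one_closed, of 1] s by simp
    show "f' (x \<otimes> y) = f' x + f' y" if xy: "x \<in> B'" "y \<in> B'" for x y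
    proof -
      obtain b k b' k' where x: "x = b \<otimes> s [^] (k::int)" "b \<in> B" and y: "y = b' \<otimes> s [^] (k'::int)" "b' \<in> B"
        using xy unfolding B'_def by blast
      show ?thesis
        unfolding x(1) y(1) mult[OF x(2) y(2)] using x(2) y(2) f
        by (simp add: f'_eq algebra_simps)
    qed
    show f'b: "f' b = f b" if "b \<in> B" for b
      using f'_eq[OF that, of 0] Bc[OF that] by simp
    have "f \<one> = 0" using f[of \<one> \<one>] B.one_closed by simp
    then show "f' s = r" using f'_eq[OF B.one_closed, of 1] s by simp
  qed
qed

lemma (in group) additive_int_pow:
  fixes f :: "'a \<Rightarrow> 'c::comm_ring_1"
  assumes B: "subgroup B G" and s: "s \<in> B"
    and f: "\<And>x y. x \<in> B \<Longrightarrow> y \<in> B \<Longrightarrow> f (x \<otimes> y) = f x + f y"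
  shows "f (s [^] (k::int)) = of_int k * f s"
proof -
  interpret B: subgroup B G by (rule B)
  have sc: "s \<in> carrier G" using s B.subset by blast
  have pow: "s [^] (k::int) \<in> B" for k using subgroup_int_pow_closed[OF B s] .
  have zero: "f \<one> = 0" using f[of \<one> \<one>] B.one_closed by simp
  have step: "f (s [^] (k + 1)) = f (s [^] k) + f s" for k :: int
    using f[OF pow[of k] s] sc by (simp add: int_pow_mult)
  show ?thesis
  proof (induction k rule: int_induct[where k = 0])
    case base
    then show ?case using zero by simp
  next
    case (step1 i)
    then show ?case using step[of i] by (simp add: algebra_simps)
  next
    case (step2 i)
    then show ?case using step[of "i - 1"] by (simp add: algebra_simps)
  qed
qed

text \<open>Divisibility of the rationals lets every extension succeed: if a nonzero power of the
  new element lies in \<open>B\<close>, division by its exponent gives the forced value, and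
  otherwise 0 will do.\<close>

lemma (in comm_group) additive_to_rat:
  assumes tf: "\<And>n::int. n \<noteq> 0 \<Longrightarrow> a [^] n \<noteq> \<one>" and a: "a \<in> carrier G"
    and T: "finite T" "T \<subseteq> carrier G"
  shows "\<exists>B f. subgroup B G \<and> insert a T \<subseteq> B \<and> (\<forall>x\<in>B. \<forall>y\<in>B. f (x \<otimes> y) = f x + (f y :: rat)) \<and> f a = 1"
  using T
proof (induction T rule: finite_induct)
  case empty
  have "subgroup {\<one>} G" by (rule triv_subgroup)
  \<comment> \<open>Over the trivial subgroup compatibility concerns the exponent 0 alone, because
    \<open>a\<close> has infinite order.\<close>
  then obtain B f where "subgroup B G" "a \<in> B"
    "\<And>x y. x \<in> B \<Longrightarrow> y \<in> B \<Longrightarrow> f (x \<otimes> y) = f x + (f y :: rat)" "f a = 1"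
    by (rule extend_additive[where f = "\<lambda>_. 0" and s = a and r = 1]) (use tf a in auto)
  then show ?case by blast
next
  case (insert s T)
  then obtain B and f :: "'a \<Rightarrow> rat" where B: "subgroup B G" "insert a T \<subseteq> B"
    and f: "\<And>x y. x \<in> B \<Longrightarrow> y \<in> B \<Longrightarrow> f (x \<otimes> y) = f x + f y" and fa: "f a = 1"
    by (metis insert_subset)
  have s: "s \<in> carrier G" using insert.prems by simp
  obtain r where r: "\<And>k::int. s [^] k \<in> B \<Longrightarrow> f (s [^] k) = of_int k * r"
  proof (cases "\<exists>n::int. n \<noteq> 0 \<and> s [^] n \<in> B")
    case True
    then obtain n :: int where n: "n \<noteq> 0" "s [^] n \<in> B" by blast
    have "f (s [^] k) = of_int k * (f (s [^] n) / of_int n)" if k: "s [^] k \<in> B" for k :: int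
    proof -
      have "of_int n * f (s [^] k) = of_int k * f (s [^] n)"
        using additive_int_pow[OF B(1) k f, of n] additive_int_pow[OF B(1) n(2) f, of k] s
        by (simp add: int_pow_pow mult.commute)
      then show ?thesis using n(1) by (simp add: field_simps)
    qed
    then show ?thesis by (rule that)
  next
    case False
    have "f \<one> = 0" using f[of \<one> \<one>] subgroup.one_closed[OF B(1)] by simp
    then show ?thesis using False by (intro that[of 0]) (metis int_pow_0 mult_zero_right)
  qed
  obtain B' f' where "subgroup B' G" "B \<subseteq> B'" "s \<in> B'"
    "\<And>x y. x \<in> B' \<Longrightarrow> y \<in> B' \<Longrightarrow> f' (x \<otimes> y) = f' x + (f' y :: rat)"
    "\<And>x. x \<in> B \<Longrightarrow> f' x = f x"
    using extend_additive[OF B(1) s f r] by metis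
  moreover have "a \<in> B" using B(2) by simp
  ultimately show ?case using B(2) fa by (intro exI[of _ B'] exI[of _ f']) auto
qed

lemma common_denominator:
  fixes f :: "'a \<Rightarrow> rat"
  assumes "finite T"
  shows "\<exists>D::int. D > 0 \<and> (\<forall>s\<in>T. of_int D * f s \<in> \<int>)"
  using assms
proof (induction T rule: finite_induct)
  case empty
  then show ?case by (intro exI[of _ 1]) simp
next
  case (insert s T)
  then obtain D :: int where D: "D > 0" "\<And>t. t \<in> T \<Longrightarrow> of_int D * f t \<in> \<int>" by blast
  obtain p q where pq: "quotient_of (f s) = (p, q)" by fastforce
  have q: "q > 0" "f s = of_int p / of_int q"
    using quotient_of_denom_pos[OF pq] quotient_of_div[OF pq] by auto
  have "of_int (D * q) * f s = of_int (D * p)" using q by simp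
  then have "of_int (D * q) * f s \<in> \<int>" by (metis Ints_of_int)
  moreover have "of_int (D * q) * f t \<in> \<int>" if "t \<in> T" for t
  proof -
    have "of_int (D * q) * f t = of_int q * (of_int D * f t)" by simp
    then show ?thesis using D(2)[OF that] by (metis Ints_mult Ints_of_int)
  qed
  ultimately show ?case using D(1) q(1) by (intro exI[of _ "D * q"]) auto
qed

text \<open>The values of \<open>h\<close> form an abelian group \<open>A\<close> in which
  \<open>h g\<close> has infinite order. A rational map with value 1 at \<open>h g\<close> is
  extended over the images of the generators, hence over \<open>A\<close>, and a common denominator
  on the generators clears all values.\<close>

lemma (in group) hom_to_int_of_hom:
  assumes Q: "group Q" "torsion_free_group Q" and h: "h \<in> hom G Q"
    and comm: "\<And>x y. x \<in> carrier G \<Longrightarrow> y \<in> carrier G \<Longrightarrow> h x \<otimes>\<^bsub>Q\<^esub> h y = h y \<otimes>\<^bsub>Q\<^esub> h x"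
    and g: "g \<in> carrier G" "h g \<noteq> \<one>\<^bsub>Q\<^esub>"
    and S: "finite_generating_set G S"
  obtains f :: "'a \<Rightarrow> int" where "\<And>x y. x \<in> carrier G \<Longrightarrow> y \<in> carrier G \<Longrightarrow> f (x \<otimes> y) = f x + f y"
    "f g \<noteq> 0"
proof -
  have S': "finite S" "S \<subseteq> carrier G" "generate G S = carrier G"
    using S unfolding finite_generating_set_def by auto
  interpret Q: group Q by fact
  interpret h: group_hom G Q h by unfold_locales (rule h)
  define A where "A = Q\<lparr>carrier := h ` carrier G\<rparr>"
  have sub: "subgroup (h ` carrier G) Q" by (rule h.img_is_subgroup)
  have "group A" unfolding A_def by (rule subgroup.subgroup_is_group[OF sub Q(1)])
  then interpret A: comm_group A
    by (rule group.group_comm_groupI) (use comm in \<open>auto simp: A_def\<close>)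
  interpret hA: group_hom G A h
    by unfold_locales (use h in \<open>auto simp: hom_def A_def\<close>)
  have hg: "h g \<in> carrier A" using g(1) by (simp add: A_def)
  have pow: "h g [^]\<^bsub>A\<^esub> n \<noteq> \<one>\<^bsub>A\<^esub>" if "n > 0" for n :: nat
  proof -
    have "h g [^]\<^bsub>A\<^esub> n = h g [^]\<^bsub>Q\<^esub> n"
      unfolding A_def by (rule Q.nat_pow_consistent[symmetric])
    moreover have "h g [^]\<^bsub>Q\<^esub> n \<noteq> \<one>\<^bsub>Q\<^esub>"
      using Q(2) g that unfolding torsion_free_group_def by auto
    ultimately show ?thesis by (simp add: A_def)
  qed
  have ipow: "h g [^]\<^bsub>A\<^esub> n \<noteq> \<one>\<^bsub>A\<^esub>" if "n \<noteq> 0" for n :: int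
  proof (cases n)
    case (nonneg m)
    then show ?thesis using that pow[of m] by (simp add: int_pow_int)
  next
    case (neg m)
    then show ?thesis
      using pow[of "Suc m"] hg A.int_pow_neg_int[OF hg, of "Suc m"]
      by (simp only: A.inv_eq_1_iff A.nat_pow_closed) simp
  qed
  obtain B and f :: "_ \<Rightarrow> rat" where B: "subgroup B A" "insert (h g) (h ` S) \<subseteq> B"
    and f: "\<And>x y. x \<in> B \<Longrightarrow> y \<in> B \<Longrightarrow> f (x \<otimes>\<^bsub>A\<^esub> y) = f x + f y" and fg: "f (h g) = 1"
  proof -
    have "finite (h ` S)" "h ` S \<subseteq> carrier A" using S' by (auto simp: A_def)
    from A.additive_to_rat[OF ipow hg this] show ?thesis using that by blast
  qed
  have "generate A (h ` S) \<subseteq> B"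
    using B by (intro A.generate_subgroup_incl) auto
  then have hB: "h x \<in> B" if "x \<in> carrier G" for x
    using hA.generate_img[OF S'(2)] S'(3) that by auto
  define F where "F x = f (h x)" for x
  have F: "F (x \<otimes> y) = F x + F y" if "x \<in> carrier G" "y \<in> carrier G" for x y
    unfolding F_def using f[OF hB hB] that by (metis hA.hom_mult)
  obtain D :: int where D: "D > 0" "\<And>s. s \<in> S \<Longrightarrow> of_int D * F s \<in> \<int>"
    using common_denominator[OF S'(1)] by metis
  have F1: "F \<one> = 0" using F[of \<one> \<one>] by simp
  have Fint: "of_int D * F x \<in> \<int>" if "x \<in> carrier G" for x
  proof -
    have "x \<in> generate G S" using that S'(3) by simp
    then show ?thesis
    proof induction
      case (inv s)
      then have "F (inv s) = - F s"
        using F[of "inv s" s] F1 S'(2) by (auto simp: add_eq_0_iff subset_iff)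
      then show ?case using D(2)[OF inv] by simp
    next
      case (eng x y)
      then show ?case using F S'(3) by (simp add: distrib_left)
    qed (use D F1 in auto)
  qed
  have fl: "of_int \<lfloor>of_int D * F x\<rfloor> = of_int D * F x" if "x \<in> carrier G" for x
    using Fint[OF that] by (metis Ints_cases floor_of_int)
  show ?thesis
  \<comment> \<open>The floor merely changes the type: by \<open>fl\<close> its argument is already
    an integer.\<close>
  proof (rule that[of "\<lambda>x. \<lfloor>of_int D * F x\<rfloor>"])
    fix x y assume xy: "x \<in> carrier G" "y \<in> carrier G"
    have "of_int \<lfloor>of_int D * F (x \<otimes> y)\<rfloor> = of_int D * F (x \<otimes> y)"
      using xy by (intro fl) simp
    also have "\<dots> = of_int D * F x + of_int D * F y" using F[OF xy] by (simp add: distrib_left)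
    also have "\<dots> = of_int (\<lfloor>of_int D * F x\<rfloor> + \<lfloor>of_int D * F y\<rfloor>)"
      unfolding of_int_add fl[OF xy(1)] fl[OF xy(2)] ..
    finally have "(of_int \<lfloor>of_int D * F (x \<otimes> y)\<rfloor> :: rat) = of_int (\<lfloor>of_int D * F x\<rfloor> + \<lfloor>of_int D * F y\<rfloor>)" .
    then show "\<lfloor>of_int D * F (x \<otimes> y)\<rfloor> = \<lfloor>of_int D * F x\<rfloor> + \<lfloor>of_int D * F y\<rfloor>" unfolding of_int_eq_iff .
  next
    show "\<lfloor>of_int D * F g\<rfloor> \<noteq> 0" using fg D(1) unfolding F_def by simp
  qed
qed

section \<open>Residually torsion-free nilpotent groups\<close>

lemma residually_torsion_free_nilpotent_quotient:
  assumes "residually_torsion_free_nilpotent G" "g \<in> carrier G" "g \<noteq> \<one>\<^bsub>G\<^esub>"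
  obtains N where "N \<lhd> G" "torsion_free_group (G Mod N)" "nilpotent_group (G Mod N)"
    "group_hom G (G Mod N) (\<lambda>x. N #>\<^bsub>G\<^esub> x)" "N #>\<^bsub>G\<^esub> g \<noteq> \<one>\<^bsub>G Mod N\<^esub>"
proof -
  interpret group G using assms(1) unfolding residually_torsion_free_nilpotent_def by blast
  obtain N where N: "N \<lhd> G" "torsion_free_group (G Mod N)" "nilpotent_group (G Mod N)"
      "N #>\<^bsub>G\<^esub> g \<noteq> \<one>\<^bsub>G Mod N\<^esub>"
    using assms unfolding residually_torsion_free_nilpotent_def by blast
  interpret N: normal N G by (rule N(1))
  interpret Q: group "G Mod N" by (rule N.factorgroup_is_group)
  have "group_hom G (G Mod N) (\<lambda>x. N #>\<^bsub>G\<^esub> x)"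
    using N.r_coset_hom_Mod by unfold_locales
  then show ?thesis using that N by blast
qed

text \<open>Different \<open>x\<close> and \<open>y\<close> are separated by a torsion-free
  nilpotent quotient, where roots are unique.\<close>

lemma residually_torsion_free_nilpotent_unique_roots:
  assumes rtfn: "residually_torsion_free_nilpotent G" and n: "n > (0::nat)"
    and x: "x \<in> carrier G" and y: "y \<in> carrier G" and eq: "x [^]\<^bsub>G\<^esub> n = y [^]\<^bsub>G\<^esub> n"
  shows "x = y"
proof (rule ccontr)
  interpret group G using rtfn unfolding residually_torsion_free_nilpotent_def by blast
  assume "x \<noteq> y"
  then have g: "x \<otimes>\<^bsub>G\<^esub> inv\<^bsub>G\<^esub> y \<in> carrier G" "x \<otimes>\<^bsub>G\<^esub> inv\<^bsub>G\<^esub> y \<noteq> \<one>\<^bsub>G\<^esub>"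
    using x y by (auto simp: inv_solve_right')
  from residually_torsion_free_nilpotent_quotient[OF rtfn g]
  obtain N where N: "N \<lhd> G" "torsion_free_group (G Mod N)" "nilpotent_group (G Mod N)"
    "group_hom G (G Mod N) (\<lambda>x. N #>\<^bsub>G\<^esub> x)" "N #>\<^bsub>G\<^esub> (x \<otimes>\<^bsub>G\<^esub> inv\<^bsub>G\<^esub> y) \<noteq> \<one>\<^bsub>G Mod N\<^esub>" .
  interpret h: group_hom G "G Mod N" "\<lambda>x. N #>\<^bsub>G\<^esub> x" by (rule N(4))
  have "N #>\<^bsub>G\<^esub> x = N #>\<^bsub>G\<^esub> y"
  proof (rule h.H.nilpotent_torsion_free_unique_roots[OF N(3,2) n])
    show "(N #>\<^bsub>G\<^esub> x) [^]\<^bsub>G Mod N\<^esub> n = (N #>\<^bsub>G\<^esub> y) [^]\<^bsub>G Mod N\<^esub> n"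
      using h.hom_nat_pow[OF x, of n] h.hom_nat_pow[OF y, of n] eq by simp
  qed (use x y in simp_all)
  then have "N #>\<^bsub>G\<^esub> (x \<otimes>\<^bsub>G\<^esub> inv\<^bsub>G\<^esub> y) = \<one>\<^bsub>G Mod N\<^esub>"
    using h.hom_mult[OF x inv_closed[OF y]] h.hom_inv[OF y] h.H.r_inv[OF h.hom_closed[OF y]] by simp
  then show False using N(5) by simp
qed

text \<open>\<open>g\<close> only supplies a nontrivial quotient. The map may vanish at
  \<open>g\<close>, so an element \<open>t\<close> at which it does not is returned
  separately.\<close>

lemma residually_torsion_free_nilpotent_hom_to_int:
  assumes rtfn: "residually_torsion_free_nilpotent G" and S: "finite_generating_set G S"
    and g: "g \<in> carrier G" "g \<noteq> \<one>\<^bsub>G\<^esub>"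
  obtains f :: "'a \<Rightarrow> int" and t where "\<And>x y. x \<in> carrier G \<Longrightarrow> y \<in> carrier G \<Longrightarrow> f (x \<otimes>\<^bsub>G\<^esub> y) = f x + f y"
    "t \<in> carrier G" "f t \<noteq> 0"
proof -
  interpret group G using rtfn unfolding residually_torsion_free_nilpotent_def by blast
  from residually_torsion_free_nilpotent_quotient[OF rtfn g]
  obtain N where N: "N \<lhd> G" "torsion_free_group (G Mod N)" "nilpotent_group (G Mod N)"
    "group_hom G (G Mod N) (\<lambda>x. N #>\<^bsub>G\<^esub> x)" "N #>\<^bsub>G\<^esub> g \<noteq> \<one>\<^bsub>G Mod N\<^esub>" .
  interpret \<pi>: group_hom G "G Mod N" "\<lambda>x. N #>\<^bsub>G\<^esub> x" by (rule N(4))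
  obtain h where h: "h \<in> hom (G Mod N) (G Mod N)"
    and comm: "\<And>x y. x \<in> carrier (G Mod N) \<Longrightarrow> y \<in> carrier (G Mod N) \<Longrightarrow>
      h x \<otimes>\<^bsub>G Mod N\<^esub> h y = h y \<otimes>\<^bsub>G Mod N\<^esub> h x"
    and nt: "\<exists>x \<in> carrier (G Mod N). h x \<noteq> \<one>\<^bsub>G Mod N\<^esub>"
    using \<pi>.H.nilpotent_nontrivial_hom[OF N(3) \<pi>.hom_closed[OF g(1)] N(5)] by metis
  have hom: "(\<lambda>x. h (N #>\<^bsub>G\<^esub> x)) \<in> hom G (G Mod N)"
    using h \<pi>.hom_mult \<pi>.hom_closed unfolding hom_def by (auto simp: Pi_iff)
  obtain t where t: "t \<in> carrier G" "h (N #>\<^bsub>G\<^esub> t) \<noteq> \<one>\<^bsub>G Mod N\<^esub>"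
    using nt by (auto simp: carrier_FactGroup)
  obtain f :: "'a \<Rightarrow> int" where "\<And>x y. x \<in> carrier G \<Longrightarrow> y \<in> carrier G \<Longrightarrow> f (x \<otimes>\<^bsub>G\<^esub> y) = f x + f y"
    "f t \<noteq> 0"
    using hom_to_int_of_hom[OF \<pi>.H.is_group N(2) hom comm[OF \<pi>.hom_closed \<pi>.hom_closed] t S] by metis
  then show ?thesis using that t(1) by blast
qed

section \<open>The boundary action\<close>

lemma autoD:
  assumes "\<phi> \<in> auto G"
  shows "\<phi> \<in> hom G G" "bij_betw \<phi> (carrier G) (carrier G)"
    "x \<in> carrier G \<Longrightarrow> \<phi> x \<in> carrier G"
    "x \<in> carrier G \<Longrightarrow> y \<in> carrier G \<Longrightarrow> \<phi> (x \<otimes>\<^bsub>G\<^esub> y) = \<phi> x \<otimes>\<^bsub>G\<^esub> \<phi> y"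
  using assms by (auto simp: auto_def Bij_def hom_def Pi_iff)

section \<open>Hausdorff closeness and well-definedness of the action on classes\<close>

context word_metric
begin

abbreviation hausdorff_close :: "'a set \<Rightarrow> 'a set \<Rightarrow> bool" where
  "hausdorff_close \<equiv> finite_hausdorff_dist G S"

lemma hausdorff_close_sym:
  assumes "A \<subseteq> carrier G" "B \<subseteq> carrier G" "hausdorff_close A B"
  shows "hausdorff_close B A"
proof -
  obtain C where C: "\<And>a. a \<in> A \<Longrightarrow> \<exists>b\<in>B. d a b \<le> C" "\<And>b. b \<in> B \<Longrightarrow> \<exists>a\<in>A. d a b \<le> C"
    using assms(3) unfolding finite_hausdorff_dist_def by blast
  have "d a b = d b a" if "a \<in> A" "b \<in> B" for a b
    using d_commute that assms(1,2) by blast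
  then show ?thesis
    using C unfolding finite_hausdorff_dist_def by (intro exI[of _ C]) metis
qed

lemma hausdorff_close_trans:
  assumes "A \<subseteq> carrier G" "B \<subseteq> carrier G" "E \<subseteq> carrier G"
    and "hausdorff_close A B" "hausdorff_close B E"
  shows "hausdorff_close A E"
proof -
  obtain C where C: "\<And>a. a \<in> A \<Longrightarrow> \<exists>b\<in>B. d a b \<le> C" "\<And>b. b \<in> B \<Longrightarrow> \<exists>a\<in>A. d a b \<le> C"
    using assms(4) unfolding finite_hausdorff_dist_def by blast
  obtain C' where C': "\<And>b. b \<in> B \<Longrightarrow> \<exists>e\<in>E. d b e \<le> C'" "\<And>e. e \<in> E \<Longrightarrow> \<exists>b\<in>B. d b e \<le> C'"
    using assms(5) unfolding finite_hausdorff_dist_def by blast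
  have tri: "d a e \<le> C + C'" if "a \<in> A" "b \<in> B" "e \<in> E" "d a b \<le> C" "d b e \<le> C'" for a b e
    using d_triangle[of a b e] that assms(1-3) by fastforce
  have "\<exists>e\<in>E. d a e \<le> C + C'" if "a \<in> A" for a
    using C(1)[OF that] C'(1) tri[OF that] by meson
  moreover have "\<exists>a\<in>A. d a e \<le> C + C'" if "e \<in> E" for e
    using C'(2)[OF that] C(2) tri[OF _ _ that] by meson
  ultimately show ?thesis unfolding finite_hausdorff_dist_def by blast
qed

lemma hausdorff_close_refl: "A \<subseteq> carrier G \<Longrightarrow> hausdorff_close A A"
  unfolding finite_hausdorff_dist_def by (intro exI[of _ 0]) (metis d_self le0 subsetD)

lemma hom_lipschitz:
  assumes "\<phi> \<in> hom G G"
  obtains K where "\<And>x y. x \<in> carrier G \<Longrightarrow> y \<in> carrier G \<Longrightarrow> d (\<phi> x) (\<phi> y) \<le> K * d x y"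
proof -
  interpret \<phi>: group_hom G G \<phi> by unfold_locales (rule assms)
  obtain K where K: "\<And>g. g \<in> carrier G \<Longrightarrow> len (\<phi> g) \<le> K * len g"
    using subadditive_le_len[of "\<lambda>g. len (\<phi> g)"] len_mult_le by auto
  have "d (\<phi> x) (\<phi> y) \<le> K * d x y" if "x \<in> carrier G" "y \<in> carrier G" for x y
    unfolding word_dist_def using K[of "inv x \<otimes> y"] that by simp
  then show ?thesis by (rule that)
qed

lemma hausdorff_close_image:
  assumes "\<phi> \<in> hom G G" "A \<subseteq> carrier G" "B \<subseteq> carrier G" "hausdorff_close A B"
  shows "hausdorff_close (\<phi> ` A) (\<phi> ` B)"
proof -
  obtain C where C: "\<And>a. a \<in> A \<Longrightarrow> \<exists>b\<in>B. d a b \<le> C" "\<And>b. b \<in> B \<Longrightarrow> \<exists>a\<in>A. d a b \<le> C"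
    using assms(4) unfolding finite_hausdorff_dist_def by blast
  obtain K where K: "\<And>x y. x \<in> carrier G \<Longrightarrow> y \<in> carrier G \<Longrightarrow> d (\<phi> x) (\<phi> y) \<le> K * d x y"
    using hom_lipschitz[OF assms(1)] by blast
  have le: "d (\<phi> a) (\<phi> b) \<le> K * C" if "a \<in> A" "b \<in> B" "d a b \<le> C" for a b
    using K[of a b] that assms(2,3) by (meson le_trans mult_le_mono2 subsetD)
  have "\<exists>b\<in>\<phi> ` B. d a b \<le> K * C" if "a \<in> \<phi> ` A" for a
    using that C(1) le by blast
  moreover have "\<exists>a\<in>\<phi> ` A. d a b \<le> K * C" if "b \<in> \<phi> ` B" for b
    using that C(2) le by blast
  ultimately show ?thesis unfolding finite_hausdorff_dist_def by blast
qed

lemma rayD: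
  assumes "\<gamma> \<in> geodesic_rays G S"
  shows "\<gamma> 0 = \<one>" "\<gamma> n \<in> carrier G" "range \<gamma> \<subseteq> carrier G" "len (\<gamma> n) = n"
proof -
  show *: "\<gamma> 0 = \<one>" "\<gamma> n \<in> carrier G" "range \<gamma> \<subseteq> carrier G"
    using assms unfolding geodesic_rays_def by auto
  have "d (\<gamma> 0) (\<gamma> n) = n - 0" using assms unfolding geodesic_rays_def by blast
  then show "len (\<gamma> n) = n" using * d_one_left by simp
qed

text \<open>Since \<open>len (\<gamma> n) = n\<close> for rays from \<open>\<one>\<close>, a point
  \<open>\<eta> k\<close> within \<open>C\<close> of \<open>\<gamma> n\<close> has \<open>k\<close>
  within \<open>C\<close> of \<open>n\<close>. So \<open>\<gamma> n\<close> and
  \<open>\<eta> n\<close> are within \<open>2 * C\<close>.\<close>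

lemma ray_equiv_iff:
  "(\<gamma>, \<eta>) \<in> ray_equiv G S \<longleftrightarrow>
    \<gamma> \<in> geodesic_rays G S \<and> \<eta> \<in> geodesic_rays G S \<and> hausdorff_close (range \<gamma>) (range \<eta>)"
proof -
  have "(\<exists>C. \<forall>n. d (\<gamma> n) (\<eta> n) \<le> C) \<longleftrightarrow> hausdorff_close (range \<gamma>) (range \<eta>)"
    if \<gamma>: "\<gamma> \<in> geodesic_rays G S" and \<eta>: "\<eta> \<in> geodesic_rays G S"
  proof
    assume "\<exists>C. \<forall>n. d (\<gamma> n) (\<eta> n) \<le> C"
    then show "hausdorff_close (range \<gamma>) (range \<eta>)"
      unfolding finite_hausdorff_dist_def by blast
  next
    assume "hausdorff_close (range \<gamma>) (range \<eta>)"
    then obtain C where C: "\<And>n. \<exists>k. d (\<gamma> n) (\<eta> k) \<le> C"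
      unfolding finite_hausdorff_dist_def by blast
    have "d (\<gamma> n) (\<eta> n) \<le> 2 * C" for n
    proof -
      note c = rayD(2)[OF \<gamma>] rayD(2)[OF \<eta>]
      obtain k where k: "d (\<gamma> n) (\<eta> k) \<le> C" using C by blast
      have "k \<le> n + C"
        using d_triangle[OF one_closed c(1)[of n] c(2)[of k]] k rayD(4)[OF \<gamma>] rayD(4)[OF \<eta>]
        by (simp add: d_one_left c)
      moreover have "n \<le> k + C"
        using d_triangle[OF one_closed c(2)[of k] c(1)[of n]] k rayD(4)[OF \<gamma>] rayD(4)[OF \<eta>]
          d_commute[OF c(1)[of n] c(2)[of k]]
        by (simp add: d_one_left c)
      moreover have "d (\<eta> k) (\<eta> n) = (if k \<le> n then n - k else k - n)"
        using \<eta> d_commute[OF c(2)[of k] c(2)[of n]] unfolding geodesic_rays_def by auto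
      ultimately have "d (\<eta> k) (\<eta> n) \<le> C" by (auto split: if_splits)
      then show ?thesis using d_triangle[OF c(1)[of n] c(2)[of k] c(2)[of n]] k by linarith
    qed
    then show "\<exists>C. \<forall>n. d (\<gamma> n) (\<eta> n) \<le> C" by blast
  qed
  then show ?thesis unfolding ray_equiv_def by auto
qed

lemma equiv_ray_equiv: "equiv (geodesic_rays G S) (ray_equiv G S)"
proof (rule equivI)
  show "ray_equiv G S \<subseteq> geodesic_rays G S \<times> geodesic_rays G S"
    by (auto simp: ray_equiv_def)
  show "refl_on (geodesic_rays G S) (ray_equiv G S)"
    by (rule refl_onI) (simp add: ray_equiv_iff rayD(3) hausdorff_close_refl)
  show "sym (ray_equiv G S)"
    by (rule symI) (simp add: ray_equiv_iff, metis rayD(3) hausdorff_close_sym)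
  show "trans (ray_equiv G S)"
    by (rule transI) (simp add: ray_equiv_iff, metis rayD(3) hausdorff_close_trans)
qed

lemma boundaryE:
  assumes "\<xi> \<in> gromov_boundary G S"
  obtains \<gamma> where "\<gamma> \<in> geodesic_rays G S" "\<xi> = ray_equiv G S `` {\<gamma>}"
  using assms unfolding gromov_boundary_def by (auto elim: quotientE)

lemma boundaryI: "\<gamma> \<in> geodesic_rays G S \<Longrightarrow> ray_equiv G S `` {\<gamma>} \<in> gromov_boundary G S"
  unfolding gromov_boundary_def by (rule quotientI)

lemma auto_inverse:
  assumes "\<phi> \<in> auto G"
  obtains \<psi> where "\<psi> \<in> auto G" "\<And>x. x \<in> carrier G \<Longrightarrow> \<psi> (\<phi> x) = x"
    "\<And>x. x \<in> carrier G \<Longrightarrow> \<phi> (\<psi> x) = x"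
proof
  let ?\<psi> = "restrict (inv_into (carrier G) \<phi>) (carrier G)"
  show "?\<psi> \<in> auto G"
    using assms restrict_inv_into_hom restrict_inv_into_Bij by (auto simp: auto_def)
  show "?\<psi> (\<phi> x) = x" "\<phi> (?\<psi> x) = x" if "x \<in> carrier G" for x
    using that autoD[OF assms] by (auto simp: bij_betw_def f_inv_into_f)
qed

text \<open>The lower bound is the Lipschitz bound of the inverse automorphism.\<close>

lemma bilip_auto_ray:
  assumes \<phi>: "\<phi> \<in> auto G" and \<gamma>: "\<gamma> \<in> geodesic_rays G S"
  obtains K where "bilip K UNIV (\<phi> \<circ> \<gamma>)"
proof -
  obtain \<psi> where \<psi>: "\<psi> \<in> auto G" "\<And>x. x \<in> carrier G \<Longrightarrow> \<psi> (\<phi> x) = x"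
    using auto_inverse[OF \<phi>] by blast
  obtain K1 where K1: "\<And>x y. x \<in> carrier G \<Longrightarrow> y \<in> carrier G \<Longrightarrow> d (\<phi> x) (\<phi> y) \<le> K1 * d x y"
    using hom_lipschitz[OF autoD(1)[OF \<phi>]] by blast
  obtain K2 where K2: "\<And>x y. x \<in> carrier G \<Longrightarrow> y \<in> carrier G \<Longrightarrow> d (\<psi> x) (\<psi> y) \<le> K2 * d x y"
    using hom_lipschitz[OF autoD(1)[OF \<psi>(1)]] by blast
  note c = rayD(2)[OF \<gamma>] and \<phi>c = autoD(3)[OF \<phi>]
  have "bilip (K1 + K2) UNIV (\<phi> \<circ> \<gamma>)"
    unfolding bilip_def
  proof (intro conjI ballI impI)
    show "(\<phi> \<circ> \<gamma>) i \<in> carrier G" for i using c \<phi>c by simp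
    fix i j :: nat assume "i \<le> j"
    then have ij: "d (\<gamma> i) (\<gamma> j) = j - i" using \<gamma> unfolding geodesic_rays_def by blast
    show "d ((\<phi> \<circ> \<gamma>) i) ((\<phi> \<circ> \<gamma>) j) \<le> (K1 + K2) * (j - i)"
      using K1[OF c c, of i j] ij by (simp add: trans_le_add1 distrib_right)
    show "j - i \<le> (K1 + K2) * d ((\<phi> \<circ> \<gamma>) i) ((\<phi> \<circ> \<gamma>) j)"
      using K2[OF \<phi>c[OF c] \<phi>c[OF c], of i j] ij \<psi>(2)[OF c] by (simp add: trans_le_add2 distrib_right)
  qed
  then show ?thesis by (rule that)
qed

text \<open>Homomorphisms are Lipschitz and so preserve Hausdorff closeness; hence the image class
  can be computed from a single pair of representatives.\<close>

lemma boundary_action_class: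
  assumes \<phi>: "\<phi> \<in> auto G" and \<gamma>: "\<gamma> \<in> geodesic_rays G S" and \<eta>: "\<eta> \<in> geodesic_rays G S"
    and close: "hausdorff_close (range (\<phi> \<circ> \<gamma>)) (range \<eta>)"
  shows "boundary_action G S \<phi> (ray_equiv G S `` {\<gamma>}) = ray_equiv G S `` {\<eta>}"
proof -
  have car: "range (\<phi> \<circ> \<gamma>') \<subseteq> carrier G" if "\<gamma>' \<in> geodesic_rays G S" for \<gamma>'
    using rayD(2)[OF that] autoD(3)[OF \<phi>] by auto
  have move: "hausdorff_close (range (\<phi> \<circ> \<gamma>')) (range \<eta>') \<longleftrightarrow> hausdorff_close (range \<eta>) (range \<eta>')"
    if "(\<gamma>, \<gamma>') \<in> ray_equiv G S" "\<eta>' \<in> geodesic_rays G S" for \<gamma>' \<eta>'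
  proof -
    have \<gamma>': "\<gamma>' \<in> geodesic_rays G S" and cl: "hausdorff_close (range \<gamma>) (range \<gamma>')"
      using that(1) unfolding ray_equiv_iff by auto
    have "hausdorff_close (range (\<phi> \<circ> \<gamma>)) (range (\<phi> \<circ> \<gamma>'))"
      using hausdorff_close_image[OF autoD(1)[OF \<phi>] rayD(3)[OF \<gamma>] rayD(3)[OF \<gamma>'] cl]
      by (simp add: image_comp)
    then have "hausdorff_close (range (\<phi> \<circ> \<gamma>')) (range \<eta>)"
      using close hausdorff_close_trans hausdorff_close_sym car[OF \<gamma>] car[OF \<gamma>'] rayD(3)[OF \<eta>] by metis
    then show ?thesis
      using hausdorff_close_trans hausdorff_close_sym car[OF \<gamma>'] rayD(3)[OF \<eta>] rayD(3)[OF that(2)] by metis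
  qed
  have refl: "(\<gamma>, \<gamma>) \<in> ray_equiv G S"
    using \<gamma> by (simp add: ray_equiv_iff rayD(3) hausdorff_close_refl)
  have "boundary_action G S \<phi> (ray_equiv G S `` {\<gamma>}) = {\<eta>' \<in> geodesic_rays G S.
      \<exists>\<gamma>'\<in>ray_equiv G S `` {\<gamma>}. hausdorff_close (range (\<phi> \<circ> \<gamma>')) (range \<eta>')}"
    unfolding boundary_action_def using boundaryI[OF \<gamma>] by simp
  also have "\<dots> = {\<eta>' \<in> geodesic_rays G S. hausdorff_close (range \<eta>) (range \<eta>')}"
    using move refl by blast
  also have "\<dots> = ray_equiv G S `` {\<eta>}"
    using \<eta> by (auto simp: ray_equiv_iff)
  finally show ?thesis .
qed

section \<open>The homomorphism to the permutations of the boundary\<close>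

context
  assumes hyperbolic: "hyperbolic_group G"
begin

lemma auto_ray_endpoint:
  assumes \<phi>: "\<phi> \<in> auto G" and \<gamma>: "\<gamma> \<in> geodesic_rays G S"
  obtains \<eta> where "\<eta> \<in> geodesic_rays G S" "hausdorff_close (range (\<phi> \<circ> \<gamma>)) (range \<eta>)"
proof -
  interpret \<phi>: group_hom G G \<phi> by unfold_locales (rule autoD(1)[OF \<phi>])
  obtain K where K: "bilip K UNIV (\<phi> \<circ> \<gamma>)" using bilip_auto_ray[OF assms] .
  have "(\<phi> \<circ> \<gamma>) 0 = \<one>" using rayD(1)[OF \<gamma>] by simp
  from bilip_ray_near_geodesic_ray[OF hyperbolic K this] show ?thesis using that by blast
qed

lemma boundary_action_closed:
  assumes \<phi>: "\<phi> \<in> auto G" and \<xi>: "\<xi> \<in> gromov_boundary G S"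
  shows "boundary_action G S \<phi> \<xi> \<in> gromov_boundary G S"
  using boundaryE[OF \<xi>] auto_ray_endpoint[OF \<phi>] boundary_action_class[OF \<phi>] boundaryI by metis

text \<open>\<open>\<chi>\<close> is kept separate because automorphisms are extensional: it is
  instantiated with \<open>compose\<close> and with the restricted identity.\<close>

lemma boundary_action_compose:
  assumes \<phi>: "\<phi> \<in> auto G" and \<psi>: "\<psi> \<in> auto G" and \<xi>: "\<xi> \<in> gromov_boundary G S"
    and \<chi>: "\<chi> \<in> auto G" "\<And>x. x \<in> carrier G \<Longrightarrow> \<chi> x = \<phi> (\<psi> x)"
  shows "boundary_action G S \<chi> \<xi> = boundary_action G S \<phi> (boundary_action G S \<psi> \<xi>)"
proof -
  obtain \<gamma> where \<gamma>: "\<gamma> \<in> geodesic_rays G S" "\<xi> = ray_equiv G S `` {\<gamma>}" using boundaryE[OF \<xi>] .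
  obtain \<eta> where \<eta>: "\<eta> \<in> geodesic_rays G S" "hausdorff_close (range (\<psi> \<circ> \<gamma>)) (range \<eta>)"
    using auto_ray_endpoint[OF \<psi> \<gamma>(1)] .
  obtain \<zeta> where \<zeta>: "\<zeta> \<in> geodesic_rays G S" "hausdorff_close (range (\<phi> \<circ> \<eta>)) (range \<zeta>)"
    using auto_ray_endpoint[OF \<phi> \<eta>(1)] .
  have \<psi>\<gamma>: "range (\<psi> \<circ> \<gamma>) \<subseteq> carrier G" using rayD(2)[OF \<gamma>(1)] autoD(3)[OF \<psi>] by auto
  have "range (\<chi> \<circ> \<gamma>) = \<phi> ` range (\<psi> \<circ> \<gamma>)"
    using \<chi>(2) rayD(2)[OF \<gamma>(1)] by (auto simp: image_iff)
  then have "hausdorff_close (range (\<chi> \<circ> \<gamma>)) (range (\<phi> \<circ> \<eta>))"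
    using hausdorff_close_image[OF autoD(1)[OF \<phi>] \<psi>\<gamma> rayD(3)[OF \<eta>(1)] \<eta>(2)]
    by (simp add: image_comp)
  moreover have "range (\<chi> \<circ> \<gamma>) \<subseteq> carrier G" "range (\<phi> \<circ> \<eta>) \<subseteq> carrier G"
    using rayD(2)[OF \<gamma>(1)] autoD(3)[OF \<chi>(1)] rayD(2)[OF \<eta>(1)] autoD(3)[OF \<phi>] by auto
  ultimately have "hausdorff_close (range (\<chi> \<circ> \<gamma>)) (range \<zeta>)"
    using \<zeta>(2) rayD(3)[OF \<zeta>(1)] hausdorff_close_trans by blast
  then show ?thesis
    using boundary_action_class[OF \<chi>(1) \<gamma>(1) \<zeta>(1)] boundary_action_class[OF \<psi> \<gamma>(1) \<eta>]
      boundary_action_class[OF \<phi> \<eta>(1) \<zeta>] \<gamma>(2) by simp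
qed

lemma boundary_action_id:
  assumes \<phi>: "\<phi> \<in> auto G" and id: "\<And>x. x \<in> carrier G \<Longrightarrow> \<phi> x = x" and \<xi>: "\<xi> \<in> gromov_boundary G S"
  shows "boundary_action G S \<phi> \<xi> = \<xi>"
proof -
  obtain \<gamma> where \<gamma>: "\<gamma> \<in> geodesic_rays G S" "\<xi> = ray_equiv G S `` {\<gamma>}" using boundaryE[OF \<xi>] .
  have "\<phi> \<circ> \<gamma> = \<gamma>" using id rayD(2)[OF \<gamma>(1)] by auto
  then show ?thesis
    using boundary_action_class[OF \<phi> \<gamma>(1,1)] hausdorff_close_refl rayD(3)[OF \<gamma>(1)] \<gamma>(2) by simp
qed

lemma boundary_action_Bij:
  assumes \<phi>: "\<phi> \<in> auto G"
  shows "boundary_action G S \<phi> \<in> Bij (gromov_boundary G S)"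
proof -
  obtain \<psi> where \<psi>: "\<psi> \<in> auto G" "\<And>x. x \<in> carrier G \<Longrightarrow> \<psi> (\<phi> x) = x"
    "\<And>x. x \<in> carrier G \<Longrightarrow> \<phi> (\<psi> x) = x"
    using auto_inverse[OF \<phi>] by blast
  have "(\<lambda>x \<in> carrier G. x) \<in> auto G" by (rule id_in_auto)
  then have inverse: "boundary_action G S \<phi> (boundary_action G S \<psi> \<xi>) = \<xi>"
    "boundary_action G S \<psi> (boundary_action G S \<phi> \<xi>) = \<xi>" if "\<xi> \<in> gromov_boundary G S" for \<xi>
    using boundary_action_compose[OF \<phi> \<psi>(1) that, of "\<lambda>x \<in> carrier G. x"]
      boundary_action_compose[OF \<psi>(1) \<phi> that, of "\<lambda>x \<in> carrier G. x"] \<psi>(2,3)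
      boundary_action_id[OF _ _ that, of "\<lambda>x \<in> carrier G. x"] by simp_all
  have "bij_betw (boundary_action G S \<phi>) (gromov_boundary G S) (gromov_boundary G S)"
    by (rule bij_betw_byWitness[where f' = "boundary_action G S \<psi>"])
      (use inverse boundary_action_closed \<phi> \<psi>(1) in auto)
  moreover have "boundary_action G S \<phi> \<in> extensional (gromov_boundary G S)"
    unfolding boundary_action_def by (rule restrict_extensional)
  ultimately show ?thesis unfolding Bij_def by simp
qed

lemma carrier_AutoGroup: "carrier (AutoGroup G) = auto G"
  by (simp add: AutoGroup_def)

lemma mult_AutoGroup:
  "\<phi> \<in> auto G \<Longrightarrow> \<psi> \<in> auto G \<Longrightarrow> \<phi> \<otimes>\<^bsub>AutoGroup G\<^esub> \<psi> = compose (carrier G) \<phi> \<psi>"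
  by (simp add: AutoGroup_def BijGroup_def auto_def)

lemma boundary_action_group_hom:
  "group_hom (AutoGroup G) (BijGroup (gromov_boundary G S)) (boundary_action G S)"
proof (intro group_hom.intro group_hom_axioms.intro)
  show "group (AutoGroup G)" by (rule AutoGroup)
  show "group (BijGroup (gromov_boundary G S))" by (rule group_BijGroup)
  show "boundary_action G S \<in> hom (AutoGroup G) (BijGroup (gromov_boundary G S))"
  proof (rule homI)
    fix \<phi> assume "\<phi> \<in> carrier (AutoGroup G)"
    then show "boundary_action G S \<phi> \<in> carrier (BijGroup (gromov_boundary G S))"
      using boundary_action_Bij by (simp add: carrier_AutoGroup BijGroup_def)
  next
    fix \<phi> \<psi> assume "\<phi> \<in> carrier (AutoGroup G)" "\<psi> \<in> carrier (AutoGroup G)"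
    then have \<phi>: "\<phi> \<in> auto G" and \<psi>: "\<psi> \<in> auto G" by (simp_all add: carrier_AutoGroup)
    have \<chi>: "compose (carrier G) \<phi> \<psi> \<in> auto G"
      using group.is_monoid[OF AutoGroup] monoid.m_closed[of "AutoGroup G" \<phi> \<psi>] \<phi> \<psi>
      by (simp add: carrier_AutoGroup mult_AutoGroup)
    have "boundary_action G S (compose (carrier G) \<phi> \<psi>)
      = compose (gromov_boundary G S) (boundary_action G S \<phi>) (boundary_action G S \<psi>)"
    proof (rule extensionalityI)
      show "boundary_action G S (compose (carrier G) \<phi> \<psi>) \<in> extensional (gromov_boundary G S)"
        using boundary_action_Bij[OF \<chi>] by (simp add: Bij_def)
      fix \<xi> assume \<xi>: "\<xi> \<in> gromov_boundary G S"
      show "boundary_action G S (compose (carrier G) \<phi> \<psi>) \<xi>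
        = compose (gromov_boundary G S) (boundary_action G S \<phi>) (boundary_action G S \<psi>) \<xi>"
        using boundary_action_compose[OF \<phi> \<psi> \<xi> \<chi>] \<xi> by (simp add: compose_eq)
    qed (rule compose_extensional)
    then show "boundary_action G S (\<phi> \<otimes>\<^bsub>AutoGroup G\<^esub> \<psi>) =
      boundary_action G S \<phi> \<otimes>\<^bsub>BijGroup (gromov_boundary G S)\<^esub> boundary_action G S \<psi>"
      using mult_AutoGroup[OF \<phi> \<psi>] boundary_action_Bij[OF \<phi>] boundary_action_Bij[OF \<psi>]
      by (simp add: BijGroup_def)
  qed
qed

end

end

section \<open>Faithfulness\<close>

context word_metric
begin

lemma additive_nat_pow:
  fixes f :: "'a \<Rightarrow> int"
  assumes f: "\<And>x y. x \<in> carrier G \<Longrightarrow> y \<in> carrier G \<Longrightarrow> f (x \<otimes> y) = f x + f y"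
    and g: "g \<in> carrier G"
  shows "f (g [^] (n::nat)) = int n * f g"
  using additive_int_pow[OF subgroup_self g f, of "int n"] by (simp add: int_pow_int)

lemma bilip_powers:
  fixes f :: "'a \<Rightarrow> int"
  assumes f: "\<And>x y. x \<in> carrier G \<Longrightarrow> y \<in> carrier G \<Longrightarrow> f (x \<otimes> y) = f x + f y"
    and g: "g \<in> carrier G" "f g \<noteq> 0"
  obtains K where "bilip K UNIV (\<lambda>n. g [^] n)"
proof -
  have f1: "f \<one> = 0" using f[of \<one> \<one>] by simp
  have fp: "f (g [^] n) = int n * f g" for n :: nat
    by (rule additive_nat_pow[OF f g(1)])
  obtain L where L: "\<And>x. x \<in> carrier G \<Longrightarrow> nat \<bar>f x\<bar> \<le> L * len x"
  proof (rule subadditive_le_len[of "\<lambda>x. nat \<bar>f x\<bar>"])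
    show "nat \<bar>f (x \<otimes> y)\<bar> \<le> nat \<bar>f x\<bar> + nat \<bar>f y\<bar>" if "x \<in> carrier G" "y \<in> carrier G" for x y
      unfolding f[OF that] by linarith
  qed (use f1 in auto)
  have up: "len (g [^] n) \<le> len g * n" for n :: nat
  proof (induction n)
    case (Suc n)
    then show ?case using len_mult_le[of "g [^] n" g] g(1) by simp
  qed simp
  have low: "n \<le> L * len (g [^] n)" for n :: nat
  proof -
    have "n \<le> nat \<bar>f (g [^] n)\<bar>"
    proof -
      have "1 \<le> \<bar>f g\<bar>" using g(2) by linarith
      from mult_left_mono[OF this, of "int n"] have "int n \<le> \<bar>f (g [^] n)\<bar>"
        unfolding fp abs_mult by simp
      then show ?thesis by linarith
    qed
    then show ?thesis using L[of "g [^] n"] g(1) by simp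
  qed
  have "bilip (len g + L) UNIV (\<lambda>n. g [^] n)"
    unfolding bilip_def
  proof (intro conjI ballI impI)
    fix i j :: nat assume "i \<le> j"
    \<comment> \<open>By left invariance only the lengths of powers matter.\<close>
    then have "g [^] j = g [^] i \<otimes> g [^] (j - i)" using g(1) by (simp add: nat_pow_mult)
    then have "d (g [^] i) (g [^] j) = len (g [^] (j - i))"
      unfolding word_dist_def using g(1) by (simp add: inv_mult_cancel_left)
    then show "d (g [^] i) (g [^] j) \<le> (len g + L) * (j - i)"
        "j - i \<le> (len g + L) * d (g [^] i) (g [^] j)"
      using up[of "j - i"] low[of "j - i"] by (simp_all add: distrib_right trans_le_add1 trans_le_add2)
  qed (use g(1) in simp)
  then show ?thesis by (rule that)
qed

text \<open>Every \<open>g\<^sup>n\<close> has some \<open>h\<^sup>m\<close> nearby, and \<open>g\<^sup>-\<^sup>n h\<^sup>m\<close> then lies in a finite ball. By the pigeonhole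
  principle one value is attained infinitely often, so for two pairs \<open>(n, m)\<close> of which one is
  larger in both entries.\<close>

lemma commensurable_powers:
  assumes g: "g \<in> carrier G" and h: "h \<in> carrier G"
    and inj: "inj (\<lambda>n::nat. g [^] n)"
    and close: "hausdorff_close (range (\<lambda>n::nat. g [^] n)) (range (\<lambda>n::nat. h [^] n))"
  obtains m n :: nat where "m > 0" "n > 0" "h [^] m = g [^] n"
proof -
  obtain C where "\<And>n::nat. \<exists>m::nat. d (g [^] n) (h [^] m) \<le> C"
    using close unfolding finite_hausdorff_dist_def by blast
  then obtain m :: "nat \<Rightarrow> nat" where m: "\<And>n. d (g [^] n) (h [^] m n) \<le> C" by metis
  define b where "b n = inv (g [^] n) \<otimes> h [^] m n" for n
  have bc: "b n \<in> carrier G" for n unfolding b_def using g h by simp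
  have hm: "h [^] m n = g [^] n \<otimes> b n" for n
    unfolding b_def using g h by (simp add: mult_inv_cancel_left)
  have "finite (range b)"
    by (rule finite_subset[OF _ finite_ball[of C]]) (use m bc in \<open>auto simp: b_def word_dist_def\<close>)
  then obtain n0 where n0: "infinite {n \<in> UNIV. b n = b n0}"
    using pigeonhole_infinite[of UNIV b] by auto
  define A where "A = {n. n > n0 \<and> b n = b n0}"
  have "{n \<in> UNIV. b n = b n0} \<subseteq> A \<union> {..n0}" unfolding A_def by auto
  with n0 have A: "infinite A" by (meson finite_UnI finite_atMost finite_subset)
  \<comment> \<open>On \<open>A\<close> the factor \<open>b\<close> is constant, so
    \<open>m n\<close> determines \<open>g [^] n\<close>. Hence \<open>m\<close> is unbounded on
    \<open>A\<close>, and its value can be made larger along with the index.\<close>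
  have "inj_on m A"
  proof (rule inj_onI)
    fix k l assume kl: "k \<in> A" "l \<in> A" "m k = m l"
    then have "g [^] k \<otimes> b n0 = g [^] l \<otimes> b n0"
      using hm[of k] hm[of l] unfolding A_def by simp
    then have "g [^] k = g [^] l" using g bc by simp
    then show "k = l" using inj by (simp add: inj_eq)
  qed
  then have "infinite (m ` A)" using A finite_imageD by blast
  then obtain k where k: "k \<in> A" "m k > m n0"
    unfolding infinite_nat_iff_unbounded by blast
  have "h [^] (m k - m n0) \<otimes> h [^] m n0 = h [^] m k"
    using h k(2) by (simp add: nat_pow_mult)
  also have "\<dots> = g [^] (k - n0) \<otimes> g [^] n0 \<otimes> b n0"
    using hm[of k] k(1) g unfolding A_def by (simp add: nat_pow_mult)
  also have "\<dots> = g [^] (k - n0) \<otimes> h [^] m n0"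
    using hm[of n0] g bc by (simp add: m_assoc)
  finally have "h [^] (m k - m n0) = g [^] (k - n0)" using g h by simp
  then show ?thesis
    using that[of "m k - m n0" "k - n0"] k unfolding A_def by simp
qed

text \<open>The powers of \<open>\<phi> g\<close> are the images of the powers of \<open>g\<close>,
  hence close to \<open>\<phi> \<circ> \<eta>\<close> and to \<open>\<zeta>\<close>. As the class of
  \<open>\<eta>\<close> is fixed, \<open>\<zeta>\<close> is close to \<open>\<eta>\<close> and so to
  the powers of \<open>g\<close>.\<close>

lemma boundary_fixing_auto_commensurable:
  fixes f :: "'a \<Rightarrow> int"
  assumes hyp: "hyperbolic_group G" and \<phi>: "\<phi> \<in> auto G"
    and fix_bd: "\<And>\<xi>. \<xi> \<in> gromov_boundary G S \<Longrightarrow> boundary_action G S \<phi> \<xi> = \<xi>"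
    and f: "\<And>x y. x \<in> carrier G \<Longrightarrow> y \<in> carrier G \<Longrightarrow> f (x \<otimes> y) = f x + f y"
    and g: "g \<in> carrier G" "f g \<noteq> 0"
  obtains m n :: nat where "m > 0" "n > 0" "\<phi> g [^] m = g [^] n"
proof -
  interpret \<phi>: group_hom G G \<phi> by unfold_locales (rule autoD(1)[OF \<phi>])
  let ?q = "\<lambda>n::nat. g [^] n"
  obtain K where K: "bilip K UNIV ?q" using bilip_powers[OF f g] by blast
  obtain \<eta> where \<eta>: "\<eta> \<in> geodesic_rays G S" "hausdorff_close (range ?q) (range \<eta>)"
    using bilip_ray_near_geodesic_ray[OF hyp K] by auto
  obtain \<zeta> where \<zeta>: "\<zeta> \<in> geodesic_rays G S" "hausdorff_close (range (\<phi> \<circ> \<eta>)) (range \<zeta>)"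
    using auto_ray_endpoint[OF hyp \<phi> \<eta>(1)] .
  have "ray_equiv G S `` {\<eta>} = ray_equiv G S `` {\<zeta>}"
    using boundary_action_class[OF \<phi> \<eta>(1) \<zeta>] fix_bd[OF boundaryI[OF \<eta>(1)]] by simp
  then have "hausdorff_close (range \<eta>) (range \<zeta>)"
    using eq_equiv_class[OF _ equiv_ray_equiv \<zeta>(1)] by (simp add: ray_equiv_iff)
  moreover have "hausdorff_close (\<phi> ` range ?q) (range (\<phi> \<circ> \<eta>))"
    using hausdorff_close_image[OF \<phi>.homh _ rayD(3)[OF \<eta>(1)] \<eta>(2)] g(1) by (auto simp: image_comp)
  moreover have "\<phi> ` range ?q = range (\<lambda>n::nat. \<phi> g [^] n)"
    using g(1) by (auto simp: image_iff \<phi>.hom_nat_pow)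
  moreover have "range ?q \<subseteq> carrier G" "range (\<lambda>n::nat. \<phi> g [^] n) \<subseteq> carrier G"
      "range (\<phi> \<circ> \<eta>) \<subseteq> carrier G"
    using g(1) rayD(2)[OF \<eta>(1)] by auto
  ultimately have "hausdorff_close (range ?q) (range (\<lambda>n::nat. \<phi> g [^] n))"
    using \<eta> \<zeta> rayD(3) hausdorff_close_trans hausdorff_close_sym by metis
  moreover have "inj ?q"
  proof (rule injI)
    fix k l :: nat assume "g [^] k = g [^] l"
    then have "int k * f g = int l * f g"
      using additive_nat_pow[OF f g(1)] by metis
    then show "k = l" using g(2) by simp
  qed
  ultimately show ?thesis using commensurable_powers g(1) \<phi>.hom_closed that by blast
qed

lemma boundary_fixing_auto_additive:
  fixes f :: "'a \<Rightarrow> int"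
  assumes hyp: "hyperbolic_group G" and \<phi>: "\<phi> \<in> auto G"
    and fix_bd: "\<And>\<xi>. \<xi> \<in> gromov_boundary G S \<Longrightarrow> boundary_action G S \<phi> \<xi> = \<xi>"
    and f: "\<And>x y. x \<in> carrier G \<Longrightarrow> y \<in> carrier G \<Longrightarrow> f (x \<otimes> y) = f x + f y"
    and g: "g \<in> carrier G"
  shows "f (\<phi> g) = f g"
proof (cases "\<exists>t\<in>carrier G. f t \<noteq> 0")
  case False
  then show ?thesis using g autoD(3)[OF \<phi>] by simp
next
  case True
  interpret \<phi>: group_hom G G \<phi> by unfold_locales (rule autoD(1)[OF \<phi>])
  have fp: "f (x [^] n) = int n * f x" if "x \<in> carrier G" for x and n :: nat
    by (rule additive_nat_pow[OF f that])
  have f1: "f \<one> = 0" using f[of \<one> \<one>] by simp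
  have fi: "f (inv x) = - f x" if "x \<in> carrier G" for x
    using f[of "inv x" x] f1 that by simp
  have fip: "f (x [^] k) = k * f x" if "x \<in> carrier G" for x and k :: int
    using additive_int_pow[OF subgroup_self that f, of k] by simp
  have f\<phi>: "f (\<phi> (x \<otimes> y)) = f (\<phi> x) + f (\<phi> y)" if "x \<in> carrier G" "y \<in> carrier G" for x y
    using f that by simp
  have f\<phi>ip: "f (\<phi> (x [^] k)) = k * f (\<phi> x)" if "x \<in> carrier G" for x and k :: int
    using fip that by (simp add: \<phi>.hom_int_pow)
  \<comment> \<open>Positivity of both exponents transfers the sign.\<close>
  have pos: "f (\<phi> x) > 0" if x: "x \<in> carrier G" "f x > 0" for x
  proof -
    obtain m n :: nat where mn: "m > 0" "n > 0" "\<phi> x [^] m = x [^] n"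
      using boundary_fixing_auto_commensurable[OF hyp \<phi> fix_bd f x(1)] x(2) by auto
    then have "int m * f (\<phi> x) = int n * f x" using fp x(1) by (metis \<phi>.hom_closed)
    then show ?thesis using mn x(2) by (metis of_nat_0_less_iff zero_less_mult_pos zero_less_mult_iff)
  qed
  \<comment> \<open>As \<open>f\<close> vanishes at \<open>x\<close>, commensurability is applied to
    the additive map \<open>f \<circ> \<phi>\<close> instead.\<close>
  have zero: "f (\<phi> x) = 0" if x: "x \<in> carrier G" "f x = 0" for x
  proof (rule ccontr)
    assume "f (\<phi> x) \<noteq> 0"
    from boundary_fixing_auto_commensurable[OF hyp \<phi> fix_bd, of "\<lambda>x. f (\<phi> x)", OF _ f\<phi> x(1) this]
    obtain m n :: nat where mn: "m > 0" "n > 0" "\<phi> x [^] m = x [^] n" by blast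
    then have "int m * f (\<phi> x) = int n * f x" using fp x(1) by (metis \<phi>.hom_closed)
    then show False using mn x(2) \<open>f (\<phi> x) \<noteq> 0\<close> by simp
  qed
  \<comment> \<open>\<open>f\<close> and \<open>f \<circ> \<phi>\<close> have the same kernel and the same image, so they agree up to sign.\<close>
  define P where "P n \<longleftrightarrow> n > 0 \<and> (\<exists>x\<in>carrier G. f x = int n)" for n
  have "\<exists>n. P n"
  proof -
    obtain t where t: "t \<in> carrier G" "f t \<noteq> 0" using True by blast
    show ?thesis
    proof (cases "f t > 0")
      case True
      then show ?thesis unfolding P_def using t(1) by (intro exI[of _ "nat (f t)"]) auto
    next
      case False
      then show ?thesis
        unfolding P_def using t fi[OF t(1)] by (intro exI[of _ "nat (- f t)"]) (auto intro: bexI[of _ "inv t"])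
    qed
  qed
  \<comment> \<open>The least positive value, attained at \<open>t\<close>, is the positive
    generator of the image of \<open>f\<close>.\<close>
  then have PL: "P (LEAST n. P n)" by (rule LeastI_ex)
  then obtain t where t: "t \<in> carrier G" "f t > 0" "f t = int (LEAST n. P n)"
    unfolding P_def by auto
  have min: "f t \<le> f x" if "x \<in> carrier G" "f x > 0" for x
  proof -
    have "P (nat (f x))" unfolding P_def using that by auto
    from Least_le[of P, OF this] show ?thesis unfolding t(3) using that(2) by linarith
  qed
  \<comment> \<open>A combination of \<open>t\<close> and \<open>x\<close> in the kernel of
    \<open>f\<close> is also in the kernel of \<open>f \<circ> \<phi>\<close>.\<close>
  have proportional: "f t * f (\<phi> x) = f x * f (\<phi> t)" if x: "x \<in> carrier G" for x
  proof -
    have "f (t [^] f x \<otimes> x [^] (- f t)) = 0" using f fip t(1) x by simp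
    then have "f (\<phi> (t [^] f x \<otimes> x [^] (- f t))) = 0" by (rule zero[rotated]) (use t(1) x in simp)
    then have "f x * f (\<phi> t) + (- f t) * f (\<phi> x) = 0"
      using f\<phi>[of "t [^] f x" "x [^] (- f t)"] f\<phi>ip t(1) x by simp
    then show ?thesis by simp
  qed
  have \<phi>t: "\<phi> t \<in> carrier G" "f (\<phi> t) > 0" using pos[OF t(1,2)] t(1) by auto
  \<comment> \<open>Surjectivity yields \<open>f t * f t = f u * f (\<phi> t)\<close>. Both factors
    on the right are at least the minimal value \<open>f t\<close>, so both equal it.\<close>
  obtain u where u: "u \<in> carrier G" "\<phi> u = t"
    using autoD(2)[OF \<phi>] t(1) unfolding bij_betw_def by (metis imageE)
  have "f t * f t = f u * f (\<phi> t)" using proportional[OF u(1)] u(2) by simp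
  moreover have "f u > 0"
    using calculation t(2) \<phi>t(2) by (metis zero_less_mult_pos2 mult_pos_pos)
  then have "f t \<le> f u" using min u(1) by blast
  then have "f t * f (\<phi> t) \<le> f u * f (\<phi> t)" using \<phi>t(2) by (simp add: mult_right_mono)
  ultimately have "f t * f (\<phi> t) \<le> f t * f t" by simp
  then have "f (\<phi> t) \<le> f t" using t(2) by (rule mult_left_le_imp_le)
  with min[OF \<phi>t] have "f (\<phi> t) = f t" by simp
  then show ?thesis using proportional[OF g] t(2) by simp
qed

lemma boundary_fixing_auto_trivial:
  assumes hyp: "hyperbolic_group G" and rtfn: "residually_torsion_free_nilpotent G"
    and \<phi>: "\<phi> \<in> auto G"
    and fix_bd: "\<And>\<xi>. \<xi> \<in> gromov_boundary G S \<Longrightarrow> boundary_action G S \<phi> \<xi> = \<xi>"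
    and g: "g \<in> carrier G"
  shows "\<phi> g = g"
proof (cases "g = \<one>")
  case True
  then show ?thesis using hom_one[OF autoD(1)[OF \<phi>]] by simp
next
  case False
  obtain f :: "'a \<Rightarrow> int" and t where f: "\<And>x y. x \<in> carrier G \<Longrightarrow> y \<in> carrier G \<Longrightarrow> f (x \<otimes> y) = f x + f y"
    and t: "t \<in> carrier G" "f t \<noteq> 0"
    using residually_torsion_free_nilpotent_hom_to_int[OF rtfn gen g False] by blast
  have fixed: "\<phi> x = x" if x: "x \<in> carrier G" "f x \<noteq> 0" for x
  proof -
    obtain m n :: nat where mn: "m > 0" "n > 0" "\<phi> x [^] m = x [^] n"
      using boundary_fixing_auto_commensurable[OF hyp \<phi> fix_bd f x] by blast
    have "int m * f (\<phi> x) = int n * f x"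
      using mn(3) additive_nat_pow[OF f] x(1) autoD(3)[OF \<phi>] by metis
    then have "m = n" using boundary_fixing_auto_additive[OF hyp \<phi> fix_bd f x(1)] x(2) by simp
    then show ?thesis
      using residually_torsion_free_nilpotent_unique_roots[OF rtfn mn(1) autoD(3)[OF \<phi> x(1)] x(1)] mn(3)
      by simp
  qed
  show ?thesis
  proof (cases "f g = 0")
    case True
    \<comment> \<open>\<open>g \<otimes> t\<close> has the same nonzero value as \<open>t\<close>,
      so both are fixed and \<open>t\<close> cancels.\<close>
    then have "\<phi> (g \<otimes> t) = g \<otimes> t" using f g t by (intro fixed) auto
    then have "\<phi> g \<otimes> t = g \<otimes> t" using autoD(4)[OF \<phi> g t(1)] fixed[OF t] by simp
    then show ?thesis using g t(1) autoD(3)[OF \<phi> g] by simp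
  qed (use fixed g in blast)
qed

end

theorem theorem1p2:
  fixes G :: "('a, 'b) monoid_scheme" and S :: "'a set"
  assumes "group G"
    and "residually_torsion_free_nilpotent G"
    and "hyperbolic_group G"
    and "finite_generating_set G S"
  shows "faithful_action (AutoGroup G) (gromov_boundary G S) (boundary_action G S)"
proof -
  interpret word_metric G S
    using assms(1,4) by (intro word_metric.intro word_metric_axioms.intro)
  interpret act: group_hom "AutoGroup G" "BijGroup (gromov_boundary G S)" "boundary_action G S"
    by (rule boundary_action_group_hom[OF assms(3)])
  have "\<phi> = \<one>\<^bsub>AutoGroup G\<^esub>"
    if \<phi>: "\<phi> \<in> auto G" and triv: "boundary_action G S \<phi> = \<one>\<^bsub>BijGroup (gromov_boundary G S)\<^esub>" for \<phi>
  proof -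
    have "boundary_action G S \<phi> \<xi> = \<xi>" if "\<xi> \<in> gromov_boundary G S" for \<xi>
      using triv that by (simp add: BijGroup_def)
    then have "\<phi> x = x" if "x \<in> carrier G" for x
      using boundary_fixing_auto_trivial[OF assms(3,2) \<phi> _ that] by blast
    \<comment> \<open>Extensionality turns agreement on the carrier into equality with the unit of
      \<open>AutoGroup G\<close>.\<close>
    moreover have "\<phi> \<in> extensional (carrier G)" using \<phi> by (simp add: auto_def Bij_def)
    ultimately have "\<phi> = (\<lambda>x\<in>carrier G. x)" by (intro extensionalityI[of _ "carrier G"]) auto
    then show ?thesis by (simp add: AutoGroup_def BijGroup_def)
  qed
  then have "kernel (AutoGroup G) (BijGroup (gromov_boundary G S)) (boundary_action G S)
    = {\<one>\<^bsub>AutoGroup G\<^esub>}"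
    unfolding kernel_def using act.hom_one act.G.one_closed carrier_AutoGroup[OF assms(3)] by blast
  then have "inj_on (boundary_action G S) (carrier (AutoGroup G))"
    by (rule act.trivial_ker_imp_inj)
  then show ?thesis
    by (intro faithful_action.intro group_action.intro faithful_action_axioms.intro act.group_hom_axioms)
qed

end
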